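(* Consider the three-color urn model (white, black, green) with replacement matrix $$R=\begin{pmatrix} s & (1-s)\boldsymbol p\\ \mathbf 0 & P\end{pmatrix},$$ where $0<s<1$, $\boldsymbol p$ is a row probability vector of length $2$, $\mathbf 0=(0,0)'$, and $P$ is a $2\times2$ irreducible stochastic matrix with stationary distribution (row vector) $\boldsymbol\pi_P$. Assume $W_0>0$. Let $\lambda$ be the eigenvalue of $P$ other than $1$ and $\boldsymbol\xi$ a corresponding right eigenvector. Suppose that $R$ is diagonalizable, and let $\boldsymbol v_2$ be the following eigenvector of $R$ corresponding to $\lambda$: if $\lambda\ne s$, $\boldsymbol v_2=(c,\boldsymbol\xi')'$ with $c=(1-s)\boldsymbol p\boldsymbol\xi/(\lambda-s)$; if $\lambda=s$ (in which case diagonalizability of $R$ is equivalent to $\boldsymbol p\boldsymbol\xi=0$), $\boldsymbol v_2=(0,\boldsymbol\xi')'$. Then the following hold. (i) If $\lambda<1/2$, then $\boldsymbol C_n\boldsymbol v_2/\sqrt n\Rightarrow N\left(0,\frac{\lambda^2}{1-2\lambda}\boldsymbol\pi_P\boldsymbol\xi^2\right)$. (ii) If $\lambda=1/2$, then $\boldsymbol C_n\boldsymbol v_2/\sqrt{n\log n}\Rightarrow N\left(0,\lambda^2\boldsymbol\pi_P\boldsymbol\xi^2\right)$. (iii) If $\lambda>1/2$, then $\boldsymbol C_n\boldsymbol v_2/\Pi_n(\lambda)$ is an $L^2$-bounded martingale and $\boldsymbol C_n\boldsymbol v_2/n^\lambda$ converges almost surely to a non-degenerate random variable.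
   Context: Urn model: there are $K$ colors (here $K=3$). $\boldsymbol C_0=(W_0,B_0,G_0)$ is a row probability vector (non-negative real coordinates summing to $1$) giving the initial "numbers of balls" of each color, and $R=((r_{ij}))$ is a non-random $K\times K$ stochastic matrix. $\boldsymbol C_n=(W_n,B_n,G_n)$ is the row vector of the numbers of balls of each color after the $n$-th trial. At the $n$-th trial a ball is drawn at random, so that, given the past, color $i$ appears with probability $\boldsymbol C_{i,n-1}/n$ (the total after $n-1$ trials is $n$); if color $i$ appears, then for every $j$ the number of balls of color $j$ is increased by $r_{ij}$. The filtration $\mathcal F_n$ is the natural filtration of $(\boldsymbol C_n)$; martingales are with respect to it. Notation: $'$ denotes transpose. For a vector $\boldsymbol\xi$, $\boldsymbol\xi^2$ is the vector of squared coordinates. $\Pi_n(\lambda)=\prod_{j=0}^{n-1}\left(1+\frac{\lambda}{j+1}\right)$. $\Rightarrow$ denotes convergence in distribution. *)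

theory Defs
  imports "HOL-Probability.Probability"
begin

definition prob_vector :: "real ^ 'k \<Rightarrow> bool" where
  "prob_vector v \<longleftrightarrow> (\<forall>i. 0 \<le> v $ i) \<and> (\<Sum>i\<in>UNIV. v $ i) = 1"

definition stochastic_matrix :: "real ^ 'k ^ 'k \<Rightarrow> bool" where
  "stochastic_matrix A \<longleftrightarrow> (\<forall>i. prob_vector (A $ i))"

definition matrix_power :: "real ^ 'k ^ 'k \<Rightarrow> nat \<Rightarrow> real ^ 'k ^ 'k" where
  "matrix_power A n = (((**) A) ^^ n) (mat 1)"

definition irreducible_matrix :: "real ^ 'k ^ 'k \<Rightarrow> bool" where
  "irreducible_matrix A \<longleftrightarrow> (\<forall>i j. \<exists>n. 0 < matrix_power A n $ i $ j)"

definition stationary_distribution :: "real ^ 'k ^ 'k \<Rightarrow> real ^ 'k \<Rightarrow> bool" where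
  "stationary_distribution A v \<longleftrightarrow> prob_vector v \<and> v v* A = v"

definition right_eigenvector :: "real ^ 'k ^ 'k \<Rightarrow> real \<Rightarrow> real ^ 'k \<Rightarrow> bool" where
  "right_eigenvector A l v \<longleftrightarrow> v \<noteq> 0 \<and> A *v v = l *s v"

definition diagonalizable_matrix :: "real ^ 'k ^ 'k \<Rightarrow> bool" where
  "diagonalizable_matrix A \<longleftrightarrow>
     (\<exists>(Q :: real ^ 'k ^ 'k) (D :: real ^ 'k ^ 'k). invertible Q \<and>
        (\<forall>i j. i \<noteq> j \<longrightarrow> D $ i $ j = 0) \<and> A = Q ** D ** matrix_inv Q)"

text \<open>The \<open>n\<close>-th \<open>\<sigma>\<close>-algebra of the natural filtration is generated by \<open>X 0, \<dots>, X n\<close>.\<close>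

definition natural_filtration ::
    "'a measure \<Rightarrow> (nat \<Rightarrow> 'a \<Rightarrow> 'b::topological_space) \<Rightarrow> nat \<Rightarrow> 'a measure" where
  "natural_filtration M X n =
     sigma (space M) {X k -` A \<inter> space M | k A. k \<le> n \<and> A \<in> sets borel}"

definition martingale ::
    "'a measure \<Rightarrow> (nat \<Rightarrow> 'a measure) \<Rightarrow> (nat \<Rightarrow> 'a \<Rightarrow> real) \<Rightarrow> bool" where
  "martingale M F X \<longleftrightarrow>
     (\<forall>n. subalgebra M (F n)) \<and>
     (\<forall>m n. m \<le> n \<longrightarrow> sets (F m) \<subseteq> sets (F n)) \<and>
     (\<forall>n. X n \<in> borel_measurable (F n)) \<and>
     (\<forall>n. integrable M (X n)) \<and>
     (\<forall>m n. m \<le> n \<longrightarrow> (AE \<omega> in M. real_cond_exp M (F m) (X n) \<omega> = X m \<omega>))"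

definition L2_bounded :: "'a measure \<Rightarrow> (nat \<Rightarrow> 'a \<Rightarrow> real) \<Rightarrow> bool" where
  "L2_bounded M X \<longleftrightarrow>
     (\<exists>b. \<forall>n. integrable M (\<lambda>\<omega>. (X n \<omega>)\<^sup>2) \<and> (\<integral>\<omega>. (X n \<omega>)\<^sup>2 \<partial>M) \<le> b)"

text \<open>
  The normal law with mean \<open>m\<close> and variance \<open>v\<close>; the law with variance \<open>0\<close> is the point mass at
  \<open>m\<close>, whereas \<^const>\<open>normal_density\<close> with standard deviation \<open>0\<close> is the zero function.
\<close>

definition normal_law :: "real \<Rightarrow> real \<Rightarrow> real measure" where
  "normal_law m v =
     (if v = 0 then return borel m else density lborel (\<lambda>x. ennreal (normal_density m (sqrt v) x)))"

text \<open>
  \<open>C n\<close> is the composition of the urn after the \<open>n\<close>-th trial, and \<open>X n\<close>, for \<open>n \<ge> 1\<close>, is the color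
  drawn at the \<open>n\<close>-th trial (\<open>X 0\<close> plays no role). The past of a trial is the natural filtration of
  \<open>C\<close>.
\<close>

locale urn_model = prob_space M
  for M :: "'a measure" +
  fixes C0 :: "real ^ 'k::finite"
    and R :: "real ^ 'k ^ 'k"
    and X :: "nat \<Rightarrow> 'a \<Rightarrow> 'k"
    and C :: "nat \<Rightarrow> 'a \<Rightarrow> real ^ 'k"
  assumes initial_prob_vector: "prob_vector C0"
    and replacement_stochastic: "stochastic_matrix R"
    and color_measurable: "X n \<in> measurable M (count_space UNIV)"
    and initial: "\<omega> \<in> space M \<Longrightarrow> C 0 \<omega> = C0"
    and replacement: "\<omega> \<in> space M \<Longrightarrow> C (Suc n) \<omega> = C n \<omega> + R $ X (Suc n) \<omega>"
    and draw: "AE \<omega> in M. real_cond_exp M (natural_filtration M C n)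
                 (indicator {\<omega> \<in> space M. X (Suc n) \<omega> = i}) \<omega> = C n \<omega> $ i / real (Suc n)"

definition urn_Pi :: "nat \<Rightarrow> real \<Rightarrow> real" where
  "urn_Pi n l = (\<Prod>j<n. 1 + l / real (j + 1))"

end

theory Submission
  imports Defs "HOL-Real_Asymp.Real_Asymp"
begin

text \<open>Write \<open>Y n = C n \<bullet> v2\<close> and \<open>l\<close> for the second eigenvalue of \<open>P\<close>. Since \<open>R *v v2 = l *s v2\<close>, drawing
  color \<open>i\<close> adds \<open>l * v2 $ i\<close> to \<open>Y\<close>, and the conditional mean of this increment is
  \<open>l * Y n / (n + 1)\<close>. So \<open>Y\<close> is a linear recursion with factor \<open>1 + l / (n + 1)\<close> and bounded noise,
  and the noise at time \<open>n\<close> is seen at time \<open>N\<close> with a weight of order \<open>(N / n) powr l\<close>. The sum of the squared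
  weights is of order \<open>N\<close> for \<open>l < 1 / 2\<close> and \<open>N * ln N\<close> for \<open>l = 1 / 2\<close>, with no single step
  dominating; for \<open>l > 1 / 2\<close> the early steps dominate and there is a random limit.

  In the first two cases the characteristic function of \<open>Y\<close> is followed directly. Conditioning on
  the composition at time \<open>n\<close> and expanding to second order around the conditional mean replaces
  \<open>E (iexp (\<theta> * Y (n + 1)))\<close> by \<open>exp (- \<theta>\<^sup>2 * q / 2) * E (iexp (\<theta> * (1 + l / (n + 1)) * Y n))\<close>, up to
  a cubic error and the \<open>L\<^sup>1\<close> distance of the conditional variance from its limit \<open>q\<close>
  (\<open>characteristic_step\<close>). Iterating down to time \<open>0\<close> leaves three sums that satisfy affine
  recurrences \<open>x (n + 1) = A n * x n + c n\<close> (\<open>characteristic_expansion\<close>); a Stolz-type lemma for such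
  recurrences (\<open>recurrence_negligible\<close>, \<open>recurrence_limit\<close>) gives their growth, and Levy's continuity
  theorem finishes (\<open>clt_of_recurrences\<close>).

  The conditional variance converges for an algebraic reason. With \<open>c = v2 $ 1\<close>, the square of a
  coordinate of \<open>v2\<close> is
  \<open>(\<xi> $ 1 + \<xi> $ 2) * v2 $ j - \<xi> $ 1 * \<xi> $ 2\<close>, plus \<open>(c - \<xi> $ 1) * (c - \<xi> $ 2)\<close> for white. Hence the
  conditional second moment of the increment is a constant plus multiples of \<open>Y n / (n + 1)\<close> and of
  the proportion of white balls, and both tend to \<open>0\<close> (\<open>draw_variance_tendsto\<close>). The constant is
  the one in the theorem because \<open>\<pi>P \<bullet> \<xi> = 0\<close> forces \<open>\<pi>P \<bullet> \<xi>\<^sup>2 = - \<xi> $ 1 * \<xi> $ 2\<close>.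

  For \<open>l > 1 / 2\<close> the increments of the martingale \<open>Y n / urn_Pi n l\<close> are \<open>O (n powr - l)\<close>, so their
  second moments are summable. Kolmogorov's maximal inequality gives almost sure convergence
  (\<open>AE_convergent_mart\<close>), and \<open>urn_Pi n l\<close> is asymptotic to a multiple of \<open>n powr l\<close> by the product
  formula for the Gamma function. If the limit were a constant, then so would be the martingale at
  every time, although at the third trial both non-white colors have positive probability and give
  different increments (\<open>limit_not_constant\<close>).
\<close>

section \<open>Affine recurrences\<close>

text \<open>
  The scale \<open>s\<close> absorbs an inhomogeneity \<open>s (Suc n) - A n * s n\<close> at each step, so forcing of smaller
  order contributes at most \<open>\<epsilon> * s\<close> from some index on. What is present at that index only evolves
  under the homogeneous recurrence, which is dominated by its supersolution \<open>w\<close>, and \<open>w\<close> is of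
  smaller order than \<open>s\<close>.
\<close>

lemma recurrence_negligible:
  fixes A d \<delta> s w :: "nat \<Rightarrow> real"
  assumes rec: "\<And>n. d (Suc n) \<le> A n * d n + \<delta> n"
    and d: "\<And>n. 0 \<le> d n" and A: "\<And>n. 0 \<le> A n"
    and s: "eventually (\<lambda>n. 0 < s n) sequentially"
    and gap: "eventually (\<lambda>n. 0 < s (Suc n) - A n * s n) sequentially"
    and \<delta>: "(\<lambda>n. \<delta> n / (s (Suc n) - A n * s n)) \<longlonglongrightarrow> 0"
    and w: "eventually (\<lambda>n. 0 < w n) sequentially"
           "eventually (\<lambda>n. A n * w n \<le> w (Suc n)) sequentially"
    and ws: "(\<lambda>n. w n / s n) \<longlonglongrightarrow> 0"
  shows "(\<lambda>n. d n / s n) \<longlonglongrightarrow> 0"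
proof (rule LIMSEQ_I)
  fix e :: real assume "0 < e"
  \<comment> \<open>Any constant below \<open>e\<close> would do: \<open>h\<close> is the part of the error that the forcing may cause.\<close>
  define h where "h = e / 3"
  have h: "h > 0" using \<open>0 < e\<close> by (simp add: h_def)
  have "eventually (\<lambda>n. \<delta> n / (s (Suc n) - A n * s n) < h) sequentially"
    using \<delta> h by (rule order_tendstoD)
  with gap s w have "eventually (\<lambda>n. \<delta> n \<le> h * (s (Suc n) - A n * s n) \<and> 0 < s n \<and> 0 < w n
      \<and> A n * w n \<le> w (Suc n)) sequentially"
    by eventually_elim (auto simp: divide_simps mult.commute split: if_splits)
  then obtain m where m: "\<And>n. n \<ge> m \<Longrightarrow> \<delta> n \<le> h * (s (Suc n) - A n * s n)"
      "\<And>n. n \<ge> m \<Longrightarrow> 0 < s n" "\<And>n. n \<ge> m \<Longrightarrow> 0 < w n"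
      "\<And>n. n \<ge> m \<Longrightarrow> A n * w n \<le> w (Suc n)"
    by (auto simp: eventually_sequentially)
  \<comment> \<open>\<open>K * w\<close> carries the value at the index \<open>m\<close> forward along the homogeneous recurrence.\<close>
  define K where "K = d m / w m"
  have K: "K \<ge> 0" using d[of m] m(3)[of m] by (simp add: K_def)
  have bound: "d n \<le> h * s n + K * w n" if "n \<ge> m" for n
    using that
  proof (induction n rule: dec_induct)
    case base
    have "K * w m = d m" using m(3)[of m] by (simp add: K_def)
    then show ?case using m(2)[of m] h by simp
  next
    case (step n)
    have "d (Suc n) \<le> A n * (h * s n + K * w n) + h * (s (Suc n) - A n * s n)"
      using rec[of n] mult_left_mono[OF step.IH A[of n]] m(1)[OF step.hyps(1)] by linarith
    also have "\<dots> = h * s (Suc n) + K * (A n * w n)" by (simp add: algebra_simps)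
    also have "\<dots> \<le> h * s (Suc n) + K * w (Suc n)"
      using mult_left_mono[OF m(4)[OF step.hyps(1)] K] by simp
    finally show ?case .
  qed
  have "(\<lambda>n. h + K * (w n / s n)) \<longlonglongrightarrow> h + K * 0"
    by (intro tendsto_intros ws)
  then have "eventually (\<lambda>n. h + K * (w n / s n) < e) sequentially"
    by (rule order_tendstoD) (use h \<open>0 < e\<close> in \<open>simp add: h_def\<close>)
  moreover have "eventually (\<lambda>n. n \<ge> m) sequentially" by (rule eventually_ge_at_top)
  ultimately have "eventually (\<lambda>n. norm (d n / s n - 0) < e) sequentially"
  proof eventually_elim
    case (elim n)
    have "d n / s n \<le> (h * s n + K * w n) / s n"
      using bound[OF elim(2)] m(2)[OF elim(2)] by (simp add: divide_right_mono)
    also have "\<dots> = h + K * (w n / s n)"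
      using m(2)[OF elim(2)] by (simp add: field_simps)
    finally show ?case using elim d[of n] m(2)[OF elim(2)] by simp
  qed
  then show "\<exists>no. \<forall>n\<ge>no. norm (d n / s n - 0) < e"
    by (simp add: eventually_sequentially)
qed

text \<open>
  The multiple \<open>(c0 / \<beta>) * s\<close> solves the recurrence up to forcing that tends to \<open>0\<close>, so its distance
  from \<open>x\<close> is negligible.
\<close>

lemma recurrence_limit:
  fixes A c x s w :: "nat \<Rightarrow> real"
  assumes rec: "\<And>n. x (Suc n) = A n * x n + c n"
    and A: "\<And>n. 0 \<le> A n"
    and s: "eventually (\<lambda>n. 0 < s n) sequentially"
    and gap: "(\<lambda>n. s (Suc n) - A n * s n) \<longlonglongrightarrow> \<beta>" and \<beta>: "0 < \<beta>"
    and c: "c \<longlonglongrightarrow> c0"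
    and w: "eventually (\<lambda>n. 0 < w n) sequentially"
           "eventually (\<lambda>n. A n * w n \<le> w (Suc n)) sequentially"
    and ws: "(\<lambda>n. w n / s n) \<longlonglongrightarrow> 0"
  shows "(\<lambda>n. x n / s n) \<longlonglongrightarrow> c0 / \<beta>"
proof -
  define d where "d n = \<bar>x n - c0 / \<beta> * s n\<bar>" for n
  define \<delta> where "\<delta> n = \<bar>c n - c0 / \<beta> * (s (Suc n) - A n * s n)\<bar>" for n
  have "(\<lambda>n. \<delta> n / (s (Suc n) - A n * s n)) \<longlonglongrightarrow> \<bar>c0 - c0 / \<beta> * \<beta>\<bar> / \<beta>"
    unfolding \<delta>_def by (intro tendsto_intros c gap) (use \<beta> in auto)
  then have \<delta>0: "(\<lambda>n. \<delta> n / (s (Suc n) - A n * s n)) \<longlonglongrightarrow> 0" using \<beta> by simp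
  have step: "d (Suc n) \<le> A n * d n + \<delta> n" for n
  proof -
    have "x (Suc n) - c0 / \<beta> * s (Suc n)
        = A n * (x n - c0 / \<beta> * s n) + (c n - c0 / \<beta> * (s (Suc n) - A n * s n))"
      by (simp add: rec algebra_simps)
    then show ?thesis unfolding d_def \<delta>_def
      using abs_triangle_ineq[of "A n * (x n - c0 / \<beta> * s n)"] A[of n] by (simp add: abs_mult)
  qed
  have "(\<lambda>n. d n / s n) \<longlonglongrightarrow> 0"
    by (rule recurrence_negligible[OF step _ A s _ \<delta>0 w ws])
       (use order_tendstoD(1)[OF gap \<beta>] in \<open>auto simp: d_def\<close>)
  then have "(\<lambda>n. \<bar>x n / s n - c0 / \<beta>\<bar>) \<longlonglongrightarrow> 0"
  proof (rule Lim_transform_eventually)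
    show "eventually (\<lambda>n. d n / s n = \<bar>x n / s n - c0 / \<beta>\<bar>) sequentially"
      using s
    proof eventually_elim
      case (elim n)
      have "x n / s n - c0 / \<beta> = (x n - c0 / \<beta> * s n) / s n" using elim by (simp add: diff_divide_distrib)
      then show ?case using elim by (simp add: d_def)
    qed
  qed
  then show ?thesis using tendsto_rabs_zero_iff LIM_zero_iff by blast
qed

text \<open>
  Each sum of weighted noise terms up to time \<open>n\<close> arises in this form: one step multiplies all
  earlier weights by a power of \<open>1 + l / (n + 1)\<close> and adds a new term.
\<close>

primrec affine_rec :: "(nat \<Rightarrow> real) \<Rightarrow> (nat \<Rightarrow> real) \<Rightarrow> nat \<Rightarrow> real" where
  "affine_rec A c 0 = 0"
| "affine_rec A c (Suc n) = A n * affine_rec A c n + c n"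

lemma affine_rec_nonneg: "(\<And>n. 0 \<le> A n) \<Longrightarrow> (\<And>n. 0 \<le> c n) \<Longrightarrow> 0 \<le> affine_rec A c n"
  by (induction n) auto

lemma urn_Pi_0 [simp]: "urn_Pi 0 l = 1"
  by (simp add: urn_Pi_def)

lemma urn_Pi_Suc [simp]: "urn_Pi (Suc n) l = urn_Pi n l * (1 + l / real (Suc n))"
  by (simp add: urn_Pi_def add.commute)

section \<open>Expansions of characteristic functions and the normal law\<close>

text \<open>
  This is the second-order expansion of the characteristic function of a centred random variable with
  finitely many values \<open>D i\<close> of probability \<open>w i\<close>: the first-order term vanishes by centring.
\<close>

lemma weighted_iexp_expansion:
  fixes w D :: "'k::finite \<Rightarrow> real"
  assumes w: "\<And>i. 0 \<le> w i" "(\<Sum>i\<in>UNIV. w i) = 1"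
    and centred: "(\<Sum>i\<in>UNIV. w i * D i) = 0"
    and D: "\<And>i. \<bar>D i\<bar> \<le> B"
  shows "cmod ((\<Sum>i\<in>UNIV. complex_of_real (w i) * iexp (\<theta> * D i))
           - of_real (1 - \<theta>\<^sup>2 / 2 * (\<Sum>i\<in>UNIV. w i * (D i)\<^sup>2))) \<le> (\<bar>\<theta>\<bar> * B) ^ 3"
proof -
  define T where "T x = 1 + \<i> * complex_of_real x - complex_of_real (x\<^sup>2) / 2" for x
  have taylor: "cmod (iexp x - T x) \<le> \<bar>x\<bar> ^ 3 / 6" for x
    using iexp_approx1[of x 2]
    by (simp add: T_def numeral_2_eq_2 numeral_3_eq_3 power_mult_distrib algebra_simps)
  have "(\<Sum>i\<in>UNIV. complex_of_real (w i) * T (\<theta> * D i))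
      = of_real (\<Sum>i\<in>UNIV. w i) + \<i> * of_real (\<theta> * (\<Sum>i\<in>UNIV. w i * D i))
          - of_real (\<theta>\<^sup>2 / 2 * (\<Sum>i\<in>UNIV. w i * (D i)\<^sup>2))"
    by (simp add: T_def sum.distrib sum_subtractf sum_distrib_left algebra_simps
          power_mult_distrib sum_divide_distrib)
  then have T_sum: "(\<Sum>i\<in>UNIV. complex_of_real (w i) * T (\<theta> * D i))
      = of_real (1 - \<theta>\<^sup>2 / 2 * (\<Sum>i\<in>UNIV. w i * (D i)\<^sup>2))"
    by (simp add: w centred)
  have "cmod ((\<Sum>i\<in>UNIV. complex_of_real (w i) * iexp (\<theta> * D i))
           - of_real (1 - \<theta>\<^sup>2 / 2 * (\<Sum>i\<in>UNIV. w i * (D i)\<^sup>2)))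
      = cmod (\<Sum>i\<in>UNIV. complex_of_real (w i) * (iexp (\<theta> * D i) - T (\<theta> * D i)))"
    by (simp only: T_sum[symmetric] right_diff_distrib sum_subtractf)
  also have "\<dots> \<le> (\<Sum>i\<in>UNIV. w i * (\<bar>\<theta>\<bar> * B) ^ 3)"
  proof (intro sum_norm_le)
    fix i
    have "cmod (iexp (\<theta> * D i) - T (\<theta> * D i)) \<le> \<bar>\<theta> * D i\<bar> ^ 3 / 6" by (rule taylor)
    also have "\<dots> \<le> \<bar>\<theta> * D i\<bar> ^ 3" by simp
    also have "\<dots> \<le> (\<bar>\<theta>\<bar> * B) ^ 3"
      by (intro power_mono) (auto simp: abs_mult intro!: mult_left_mono D)
    finally show "cmod (complex_of_real (w i) * (iexp (\<theta> * D i) - T (\<theta> * D i)))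
        \<le> w i * (\<bar>\<theta>\<bar> * B) ^ 3"
      by (simp add: norm_mult w mult_left_mono del: of_real_mult)
  qed
  finally show ?thesis by (simp add: w flip: sum_distrib_right)
qed

text \<open>
  The true order is \<open>y ^ 4\<close> near \<open>0\<close> and \<open>y\<^sup>2\<close> at infinity; the cube lies between the two, so it is a
  bound on the whole half-line, of the same form as the error in \<open>weighted_iexp_expansion\<close>.
\<close>

lemma exp_minus_expansion:
  fixes y :: real assumes "0 \<le> y"
  shows "\<bar>exp (- (y\<^sup>2 / 2)) - (1 - y\<^sup>2 / 2)\<bar> \<le> y ^ 3"
proof -
  define x where "x = y\<^sup>2 / 2"
  have x: "0 \<le> x" by (simp add: x_def)
  have lower: "1 - x \<le> exp (- x)" using exp_ge_add_one_self[of "- x"] by simp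
  show ?thesis
  proof (cases "y \<le> 1")
    case True
    have "1 \<le> (1 - x + x\<^sup>2) * (1 + x)" using x by (simp add: algebra_simps power2_eq_square)
    moreover have "1 - x + x\<^sup>2 \<ge> 0" using zero_le_power2[of "x - 1/2"] by (simp add: power2_eq_square algebra_simps)
    ultimately have "1 \<le> (1 - x + x\<^sup>2) * exp x"
      using mult_left_mono[OF exp_ge_add_one_self[of x], of "1 - x + x\<^sup>2"] by linarith
    then have "exp (- x) \<le> 1 - x + x\<^sup>2" by (simp add: exp_minus field_simps)
    moreover have "x\<^sup>2 \<le> y ^ 3"
    proof -
      have "x\<^sup>2 = y ^ 3 * y / 4" by (simp add: x_def power2_eq_square power3_eq_cube)
      also have "\<dots> \<le> y ^ 3 * 1 / 4" using assms True by (intro divide_right_mono mult_left_mono) auto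
      also have "\<dots> \<le> y ^ 3" using assms by simp
      finally show ?thesis .
    qed
    ultimately show ?thesis using lower unfolding x_def[symmetric] by linarith
  next
    case False
    have "exp (- x) \<le> 1" using x by simp
    moreover have "x \<le> y ^ 3"
    proof -
      have "x \<le> y\<^sup>2 * 1" by (simp add: x_def)
      also have "\<dots> \<le> y\<^sup>2 * y" using False by (intro mult_left_mono) auto
      finally show ?thesis by (simp add: power2_eq_square power3_eq_cube)
    qed
    ultimately show ?thesis using lower x unfolding x_def[symmetric] by linarith
  qed
qed

lemma real_distribution_normal_law: "0 \<le> v \<Longrightarrow> real_distribution (normal_law 0 v)"
proof (cases "v = 0")
  case True
  then show ?thesis
    by (auto simp: normal_law_def real_distribution_def real_distribution_axioms_def intro!: prob_space_return)
next
  case False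
  assume "0 \<le> v"
  then have "sqrt v > 0" using False by simp
  then show ?thesis using False
    by (auto simp: normal_law_def real_distribution_def real_distribution_axioms_def
             intro!: prob_space_normal_density)
qed

text \<open>
  For \<open>v > 0\<close> this is the standard normal case after a change of scale; the law with \<open>v = 0\<close> is a
  point mass and has the characteristic function \<open>1\<close> of the same form.
\<close>

lemma char_normal_law:
  assumes "0 \<le> v" shows "char (normal_law 0 v) t = of_real (exp (- (v * t\<^sup>2 / 2)))"
proof (cases "v = 0")
  case True
  then show ?thesis by (simp add: normal_law_def char_def integral_return)
next
  case False
  define \<sigma> where "\<sigma> = sqrt v"
  have \<sigma>: "\<sigma> > 0" "\<sigma>\<^sup>2 = v" using False assms by (simp_all add: \<sigma>_def)
  have "char (normal_law 0 v) t = (\<integral>x. normal_density 0 \<sigma> x *\<^sub>R iexp (t * x) \<partial>lborel)"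
    using False by (simp add: char_def normal_law_def \<sigma>_def integral_density)
  also have "\<dots> = \<sigma> *\<^sub>R (\<integral>x. normal_density 0 \<sigma> (0 + \<sigma> * x) *\<^sub>R iexp (t * (0 + \<sigma> * x)) \<partial>lborel)"
    using lborel_integral_real_affine[of \<sigma> "\<lambda>x. normal_density 0 \<sigma> x *\<^sub>R iexp (t * x)" 0] \<sigma> by simp
  also have "\<dots> = (\<integral>x. std_normal_density x *\<^sub>R iexp ((t * \<sigma>) * x) \<partial>lborel)"
  proof -
    have "\<sigma> *\<^sub>R normal_density 0 \<sigma> (0 + \<sigma> * x) *\<^sub>R iexp (t * (0 + \<sigma> * x))
        = std_normal_density x *\<^sub>R iexp ((t * \<sigma>) * x)" for x
      using \<sigma>(1) by (simp add: normal_density_def power_mult_distrib real_sqrt_mult mult_ac)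
    then show ?thesis by (simp flip: integral_scaleR_right)
  qed
  also have "\<dots> = char std_normal_distribution (t * \<sigma>)"
    by (simp add: char_def integral_density)
  also have "\<dots> = of_real (exp (- (v * t\<^sup>2 / 2)))"
    by (simp add: char_std_normal_distribution power_mult_distrib \<sigma>(2) mult.commute)
  finally show ?thesis .
qed

section \<open>The urn and its one-step expectations\<close>

context urn_model
begin

lemma space_filtration [simp]: "space (natural_filtration M C n) = space M"
  unfolding natural_filtration_def by (rule space_measure_of) auto

lemma composition_measurable [measurable]: "C n \<in> borel_measurable M"
proof (induction n)
  case 0
  have "(\<lambda>\<omega>. C0) \<in> borel_measurable M" by simp
  then show ?case by (subst measurable_cong[OF initial])
next
  case (Suc n)
  have "(\<lambda>\<omega>. R $ X (Suc n) \<omega>) \<in> borel_measurable M"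
    by (rule measurable_compose[OF color_measurable]) simp
  then have "(\<lambda>\<omega>. C n \<omega> + R $ X (Suc n) \<omega>) \<in> borel_measurable M"
    using Suc by simp
  then show ?case by (subst measurable_cong[OF replacement])
qed

lemma sets_filtration:
  "sets (natural_filtration M C n) =
     sigma_sets (space M) {C k -` A \<inter> space M | k A. k \<le> n \<and> A \<in> sets borel}"
  unfolding natural_filtration_def by (rule sets_measure_of) auto

lemma subalgebra_filtration: "subalgebra M (natural_filtration M C n)"
  unfolding subalgebra_def sets_filtration
  by (auto intro!: sets.sigma_sets_subset measurable_sets[OF composition_measurable])

lemma filtration_mono: "m \<le> n \<Longrightarrow> sets (natural_filtration M C m) \<subseteq> sets (natural_filtration M C n)"
  unfolding sets_filtration by (rule sigma_sets_mono') (blast intro: order_trans)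

lemma filtration_imp_events:
  "A \<in> sets (natural_filtration M C n) \<Longrightarrow> A \<in> sets M"
  using subalgebra_filtration[of n] by (auto simp: subalgebra_def)

lemma composition_adapted: "k \<le> n \<Longrightarrow> C k \<in> borel_measurable (natural_filtration M C n)"
  by (rule measurableI) (auto simp: sets_filtration intro!: sigma_sets.Basic)

lemma filtration_measurable_imp:
  "f \<in> borel_measurable (natural_filtration M C n) \<Longrightarrow> f \<in> borel_measurable M"
  by (rule measurable_from_subalg[OF subalgebra_filtration])

lemma composition_nonneg: "\<omega> \<in> space M \<Longrightarrow> 0 \<le> C n \<omega> $ i"
proof (induction n)
  case 0
  then show ?case using initial_prob_vector by (simp add: initial prob_vector_def)
next
  case (Suc n)
  then show ?case using replacement_stochastic
    by (simp add: replacement stochastic_matrix_def prob_vector_def)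
qed

lemma composition_total: "\<omega> \<in> space M \<Longrightarrow> (\<Sum>i\<in>UNIV. C n \<omega> $ i) = real (Suc n)"
proof (induction n)
  case 0
  then show ?case using initial_prob_vector by (simp add: initial prob_vector_def)
next
  case (Suc n)
  then show ?case using replacement_stochastic
    by (simp add: replacement stochastic_matrix_def prob_vector_def sum.distrib)
qed

text \<open>
  After \<open>n\<close> trials there are \<open>n + 1\<close> balls, so these proportions are the conditional probabilities of
  the colors at the next trial.
\<close>

definition share :: "nat \<Rightarrow> 'k \<Rightarrow> 'a \<Rightarrow> real" where
  "share n i \<omega> = C n \<omega> $ i / real (Suc n)"

lemma share_nonneg: "\<omega> \<in> space M \<Longrightarrow> 0 \<le> share n i \<omega>"
  by (simp add: share_def composition_nonneg)

lemma share_sum: "\<omega> \<in> space M \<Longrightarrow> (\<Sum>i\<in>UNIV. share n i \<omega>) = 1"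
  by (simp add: share_def composition_total flip: sum_divide_distrib)

lemma share_le_1: "\<omega> \<in> space M \<Longrightarrow> share n i \<omega> \<le> 1"
  using member_le_sum[of i UNIV "\<lambda>i. share n i \<omega>"] by (simp add: share_sum share_nonneg)

lemma share_adapted: "k \<le> n \<Longrightarrow> share k i \<in> borel_measurable (natural_filtration M C n)"
proof -
  assume "k \<le> n"
  note [measurable] = composition_adapted[OF this]
  have "(\<lambda>\<omega>. (C k \<omega> \<bullet> axis i 1) / real (Suc k)) \<in> borel_measurable (natural_filtration M C n)"
    by measurable
  then show ?thesis by (simp add: share_def[abs_def] inner_axis)
qed

lemma share_measurable [measurable]: "share n i \<in> borel_measurable M"
  by (rule filtration_measurable_imp[OF share_adapted[of n n]]) simp

lemma inner_composition: "C n \<omega> \<bullet> v = real (Suc n) * (\<Sum>i\<in>UNIV. share n i \<omega> * v $ i)"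
  by (simp add: inner_vec_def share_def sum_distrib_left)

lemma share_average_le:
  assumes "\<omega> \<in> space M" and "\<And>i. \<bar>f i\<bar> \<le> B"
  shows "\<bar>\<Sum>i\<in>UNIV. share n i \<omega> * f i\<bar> \<le> B"
proof -
  have "\<bar>\<Sum>i\<in>UNIV. share n i \<omega> * f i\<bar> \<le> (\<Sum>i\<in>UNIV. share n i \<omega> * B)"
    by (rule order_trans[OF sum_abs])
       (auto intro!: sum_mono mult_left_mono simp: abs_mult share_nonneg assms)
  then show ?thesis using share_sum[OF assms(1)] by (simp flip: sum_distrib_right)
qed

lemma inner_composition_bound:
  assumes "\<omega> \<in> space M" shows "\<bar>C n \<omega> \<bullet> v\<bar> \<le> real (Suc n) * norm v"
  unfolding inner_composition abs_mult
  using share_average_le[OF assms, of "\<lambda>i. v $ i" "norm v"]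
  by (auto intro!: mult_left_mono simp: component_le_norm_cart)

lemma integrable_bounded:
  fixes f :: "'a \<Rightarrow> 'b::{banach, second_countable_topology}"
  assumes "f \<in> borel_measurable M" "\<And>\<omega>. \<omega> \<in> space M \<Longrightarrow> norm (f \<omega>) \<le> B"
  shows "integrable M f"
  by (rule integrable_const_bound[where B = B]) (use assms in auto)

lemma draw_decompose:
  fixes H :: "'k \<Rightarrow> 'a \<Rightarrow> 'b::real_normed_algebra_1"
  assumes "\<omega> \<in> space M"
  shows "H (X (Suc n) \<omega>) \<omega> = (\<Sum>i\<in>UNIV. H i \<omega> * indicator {\<omega> \<in> space M. X (Suc n) \<omega> = i} \<omega>)"
  using assms by (simp add: indicator_def if_distrib sum.delta cong: if_cong)

lemma draw_event [measurable]: "{\<omega> \<in> space M. X n \<omega> = i} \<in> sets M"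
proof -
  have "X n -` {i} \<inter> space M \<in> sets M" by (rule measurable_sets[OF color_measurable]) simp
  then show ?thesis by (simp add: vimage_def Int_def conj_commute)
qed

lemma draw_measurable:
  fixes H :: "'k \<Rightarrow> 'a \<Rightarrow> 'b::{real_normed_algebra_1, second_countable_topology}"
  assumes [measurable]: "\<And>i. H i \<in> borel_measurable M"
  shows "(\<lambda>\<omega>. H (X (Suc n) \<omega>) \<omega>) \<in> borel_measurable M"
proof -
  have "(\<lambda>\<omega>. \<Sum>i\<in>UNIV. H i \<omega> * indicator {\<omega> \<in> space M. X (Suc n) \<omega> = i} \<omega>) \<in> borel_measurable M"
    by measurable
  then show ?thesis by (subst measurable_cong[OF draw_decompose])
qed

text \<open>
  All that the argument uses about the drawing rule: averaging over the next color, given the past,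
  replaces it by a sum with the current proportions as weights. The function \<open>H\<close> may depend on the
  past in any way.
\<close>

lemma expectation_draw_real:
  fixes H :: "'k \<Rightarrow> 'a \<Rightarrow> real"
  assumes H: "\<And>i. H i \<in> borel_measurable (natural_filtration M C n)"
    and bound: "\<And>i \<omega>. \<omega> \<in> space M \<Longrightarrow> \<bar>H i \<omega>\<bar> \<le> B"
  shows "(\<integral>\<omega>. H (X (Suc n) \<omega>) \<omega> \<partial>M) = (\<integral>\<omega>. (\<Sum>i\<in>UNIV. share n i \<omega> * H i \<omega>) \<partial>M)"
proof -
  interpret F: finite_measure_subalgebra M "natural_filtration M C n"
    by unfold_locales (rule subalgebra_filtration)
  let ?I = "\<lambda>i. indicator {\<omega> \<in> space M. X (Suc n) \<omega> = i} :: 'a \<Rightarrow> real"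
  have [measurable]: "H i \<in> borel_measurable M" for i
    by (rule filtration_measurable_imp[OF H])
  have int1: "integrable M (\<lambda>\<omega>. H i \<omega> * ?I i \<omega>)" for i
    by (rule integrable_bounded[of _ B]) (use bound order_trans[OF abs_ge_zero bound] in
       \<open>auto simp: indicator_def abs_mult\<close>)
  have int2: "integrable M (\<lambda>\<omega>. share n i \<omega> * H i \<omega>)" for i
  proof (rule integrable_bounded[of _ B])
    fix \<omega> assume w: "\<omega> \<in> space M"
    have "share n i \<omega> * \<bar>H i \<omega>\<bar> \<le> 1 * B"
      by (intro mult_mono) (use w bound[OF w, of i] share_le_1 share_nonneg in auto)
    then show "norm (share n i \<omega> * H i \<omega>) \<le> B" using w by (simp add: abs_mult share_nonneg)
  qed simp
  have "(\<integral>\<omega>. H i \<omega> * ?I i \<omega> \<partial>M) = (\<integral>\<omega>. share n i \<omega> * H i \<omega> \<partial>M)" for i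
  proof -
    have "(\<integral>\<omega>. H i \<omega> * ?I i \<omega> \<partial>M)
        = (\<integral>\<omega>. H i \<omega> * real_cond_exp M (natural_filtration M C n) (?I i) \<omega> \<partial>M)"
      using F.real_cond_exp_intg(2)[OF int1 H] by simp
    also have "\<dots> = (\<integral>\<omega>. share n i \<omega> * H i \<omega> \<partial>M)"
    proof (rule integral_cong_AE)
      show "AE \<omega> in M. H i \<omega> * real_cond_exp M (natural_filtration M C n) (?I i) \<omega>
          = share n i \<omega> * H i \<omega>"
        using draw[of n i] by eventually_elim (simp add: share_def)
    qed simp_all
    finally show ?thesis .
  qed
  then have "(\<Sum>i\<in>UNIV. (\<integral>\<omega>. H i \<omega> * ?I i \<omega> \<partial>M)) = (\<Sum>i\<in>UNIV. \<integral>\<omega>. share n i \<omega> * H i \<omega> \<partial>M)"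
    by simp
  then have "(\<integral>\<omega>. (\<Sum>i\<in>UNIV. H i \<omega> * ?I i \<omega>) \<partial>M) = (\<integral>\<omega>. (\<Sum>i\<in>UNIV. share n i \<omega> * H i \<omega>) \<partial>M)"
    by (simp only: Bochner_Integration.integral_sum[OF int1] Bochner_Integration.integral_sum[OF int2])
  moreover have "(\<integral>\<omega>. H (X (Suc n) \<omega>) \<omega> \<partial>M) = (\<integral>\<omega>. (\<Sum>i\<in>UNIV. H i \<omega> * ?I i \<omega>) \<partial>M)"
    by (rule Bochner_Integration.integral_cong[OF refl]) (rule draw_decompose)
  ultimately show ?thesis by simp
qed

lemma expectation_draw_complex:
  fixes H :: "'k \<Rightarrow> 'a \<Rightarrow> complex"
  assumes H: "\<And>i. H i \<in> borel_measurable (natural_filtration M C n)"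
    and bound: "\<And>i \<omega>. \<omega> \<in> space M \<Longrightarrow> cmod (H i \<omega>) \<le> B"
  shows "(\<integral>\<omega>. H (X (Suc n) \<omega>) \<omega> \<partial>M)
       = (\<integral>\<omega>. (\<Sum>i\<in>UNIV. complex_of_real (share n i \<omega>) * H i \<omega>) \<partial>M)"
proof -
  have [measurable]: "H i \<in> borel_measurable M" for i
    by (rule filtration_measurable_imp[OF H])
  have L: "integrable M (\<lambda>\<omega>. H (X (Suc n) \<omega>) \<omega>)"
    by (rule integrable_bounded[of _ B]) (use bound in \<open>auto intro: draw_measurable\<close>)
  have R: "integrable M (\<lambda>\<omega>. \<Sum>i\<in>UNIV. complex_of_real (share n i \<omega>) * H i \<omega>)"
  proof (intro Bochner_Integration.integrable_sum integrable_bounded[of _ B])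
    fix i \<omega> assume w: "\<omega> \<in> space M"
    have "share n i \<omega> * cmod (H i \<omega>) \<le> 1 * B"
      by (intro mult_mono) (use w bound[OF w, of i] share_le_1 share_nonneg in auto)
    then show "norm (complex_of_real (share n i \<omega>) * H i \<omega>) \<le> B"
      using w by (simp add: norm_mult share_nonneg)
  qed simp
  have re: "(\<integral>\<omega>. Re (H (X (Suc n) \<omega>) \<omega>) \<partial>M) = (\<integral>\<omega>. (\<Sum>i\<in>UNIV. share n i \<omega> * Re (H i \<omega>)) \<partial>M)"
    by (rule expectation_draw_real[where B = B])
       (use H order_trans[OF abs_Re_le_cmod bound] in auto)
  have im: "(\<integral>\<omega>. Im (H (X (Suc n) \<omega>) \<omega>) \<partial>M) = (\<integral>\<omega>. (\<Sum>i\<in>UNIV. share n i \<omega> * Im (H i \<omega>)) \<partial>M)"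
    by (rule expectation_draw_real[where B = B])
       (use H order_trans[OF abs_Im_le_cmod bound] in auto)
  show ?thesis
    by (rule complex_eqI)
       (simp_all add: integral_Re[OF L, symmetric] integral_Re[OF R, symmetric] re
          integral_Im[OF L, symmetric] integral_Im[OF R, symmetric] im)
qed

text \<open>
  The row of \<open>R\<close> drawn at a trial is added to the composition, and its product with an eigenvector is
  a coordinate of \<open>R *v v\<close>.
\<close>

lemma eigenvector_increment:
  assumes "R *v v = l *s v" "\<omega> \<in> space M"
  shows "C (Suc n) \<omega> \<bullet> v = C n \<omega> \<bullet> v + l * v $ X (Suc n) \<omega>"
proof -
  have "R $ i \<bullet> v = l * v $ i" for i
    using assms(1) by (metis matrix_vector_mul_component vector_smult_component)
  then show ?thesis by (simp add: replacement[OF assms(2)] inner_add_left)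
qed

end

section \<open>The recursion for the characteristic function\<close>

context urn_model
begin

definition draw_mean :: "real ^ 'k \<Rightarrow> nat \<Rightarrow> 'a \<Rightarrow> real" where
  "draw_mean v n \<omega> = (\<Sum>i\<in>UNIV. share n i \<omega> * v $ i)"

definition draw_variance :: "real ^ 'k \<Rightarrow> nat \<Rightarrow> 'a \<Rightarrow> real" where
  "draw_variance v n \<omega> = (\<Sum>i\<in>UNIV. share n i \<omega> * (v $ i - draw_mean v n \<omega>)\<^sup>2)"

lemma draw_mean_bound: "\<omega> \<in> space M \<Longrightarrow> \<bar>draw_mean v n \<omega>\<bar> \<le> norm v"
  unfolding draw_mean_def by (rule share_average_le) (auto simp: component_le_norm_cart)

lemma draw_mean_measurable [measurable]: "draw_mean v n \<in> borel_measurable M"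
  unfolding draw_mean_def by measurable

lemma draw_variance_measurable [measurable]: "draw_variance v n \<in> borel_measurable M"
  unfolding draw_variance_def by measurable

lemma draw_variance_eq:
  assumes "\<omega> \<in> space M"
  shows "draw_variance v n \<omega> = (\<Sum>i\<in>UNIV. share n i \<omega> * (v $ i)\<^sup>2) - (draw_mean v n \<omega>)\<^sup>2"
proof -
  let ?m = "draw_mean v n \<omega>"
  have "draw_variance v n \<omega> = (\<Sum>i\<in>UNIV. share n i \<omega> * (v $ i)\<^sup>2)
      - 2 * ?m * (\<Sum>i\<in>UNIV. share n i \<omega> * v $ i) + ?m\<^sup>2 * (\<Sum>i\<in>UNIV. share n i \<omega>)"
    by (simp add: draw_variance_def power2_diff sum.distrib sum_subtractf sum_distrib_left
        sum_distrib_right algebra_simps)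
  then show ?thesis
    using share_sum[OF assms, of n] by (simp add: draw_mean_def[symmetric] power2_eq_square)
qed

lemma draw_variance_bound: "\<omega> \<in> space M \<Longrightarrow> \<bar>draw_variance v n \<omega>\<bar> \<le> (2 * norm v)\<^sup>2"
  unfolding draw_variance_def
proof (rule share_average_le)
  fix i assume "\<omega> \<in> space M"
  have "\<bar>v $ i - draw_mean v n \<omega>\<bar> \<le> 2 * norm v"
    using draw_mean_bound[OF \<open>\<omega> \<in> space M\<close>, of v n] component_le_norm_cart[of v i] by linarith
  then show "\<bar>(v $ i - draw_mean v n \<omega>)\<^sup>2\<bar> \<le> (2 * norm v)\<^sup>2"
    using power_mono[of "\<bar>v $ i - draw_mean v n \<omega>\<bar>" "2 * norm v" 2] by simp
qed

text \<open>
  The conditional mean of the increment of \<open>C n \<bullet> v\<close> is \<open>l / (n + 1)\<close> times \<open>C n \<bullet> v\<close> itself. It is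
  therefore absorbed exactly, by changing the argument of the characteristic function from \<open>\<theta>\<close> to
  \<open>\<theta> * (1 + l / (n + 1))\<close>, and only the centred part of the increment is expanded. Replacing its
  conditional variance by the constant \<open>q\<close> costs an error in \<open>L\<^sup>1\<close>.
\<close>

lemma characteristic_step:
  assumes eig: "R *v v = l *s v" and q: "0 \<le> q"
  shows "cmod ((\<integral>\<omega>. iexp (\<theta> * (C (Suc n) \<omega> \<bullet> v)) \<partial>M)
           - of_real (exp (- (\<theta>\<^sup>2 * q / 2)))
             * (\<integral>\<omega>. iexp (\<theta> * (1 + l / real (Suc n)) * (C n \<omega> \<bullet> v)) \<partial>M))
         \<le> \<theta>\<^sup>2 / 2 * (\<integral>\<omega>. \<bar>l\<^sup>2 * draw_variance v n \<omega> - q\<bar> \<partial>M)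
           + ((2 * \<bar>l\<bar> * norm v) ^ 3 + sqrt q ^ 3) * \<bar>\<theta>\<bar> ^ 3"
proof -
  define Y where "Y \<omega> = C n \<omega> \<bullet> v" for \<omega>
  define e where "e \<omega> = iexp (\<theta> * (1 + l / real (Suc n)) * Y \<omega>)" for \<omega>
  define D where "D \<omega> i = l * (v $ i - draw_mean v n \<omega>)" for \<omega> i
  define S where "S \<omega> = (\<Sum>i\<in>UNIV. complex_of_real (share n i \<omega>) * iexp (\<theta> * D \<omega> i))" for \<omega>
  define g where "g = complex_of_real (exp (- (\<theta>\<^sup>2 * q / 2)))"
  define b where "b = ((2 * \<bar>l\<bar> * norm v) ^ 3 + sqrt q ^ 3) * \<bar>\<theta>\<bar> ^ 3"
  have [measurable]: "Y \<in> borel_measurable M" unfolding Y_def by measurable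
  have [measurable]: "e \<in> borel_measurable M" unfolding e_def by measurable
  have [measurable]: "S \<in> borel_measurable M" unfolding S_def D_def by measurable
  have ne [simp]: "cmod (e \<omega>) = 1" for \<omega> by (simp add: e_def)
  have Ymean: "Y \<omega> = real (Suc n) * draw_mean v n \<omega>" for \<omega>
    by (simp add: Y_def draw_mean_def inner_composition)
  have arg: "\<theta> * (Y \<omega> + l * v $ i) = \<theta> * (1 + l / real (Suc n)) * Y \<omega> + \<theta> * D \<omega> i" for \<omega> i
    by (simp add: Ymean D_def field_simps)
  have "(\<integral>\<omega>. iexp (\<theta> * (C (Suc n) \<omega> \<bullet> v)) \<partial>M) = (\<integral>\<omega>. iexp (\<theta> * (Y \<omega> + l * v $ X (Suc n) \<omega>)) \<partial>M)"
    by (rule Bochner_Integration.integral_cong) (simp_all add: Y_def eigenvector_increment[OF eig])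
  also have "\<dots> = (\<integral>\<omega>. (\<Sum>i\<in>UNIV. complex_of_real (share n i \<omega>) * iexp (\<theta> * (Y \<omega> + l * v $ i))) \<partial>M)"
  proof (rule expectation_draw_complex[where B = 1 and H = "\<lambda>i \<omega>. iexp (\<theta> * (Y \<omega> + l * v $ i))"])
    note [measurable] = composition_adapted[OF order_refl, of n]
    show "(\<lambda>\<omega>. iexp (\<theta> * (Y \<omega> + l * v $ i))) \<in> borel_measurable (natural_filtration M C n)" for i
      unfolding Y_def by measurable
  qed simp
  also have "\<dots> = (\<integral>\<omega>. e \<omega> * S \<omega> \<partial>M)"
  proof -
    have "iexp (\<theta> * (Y \<omega> + l * v $ i)) = e \<omega> * iexp (\<theta> * D \<omega> i)" for \<omega> i
      unfolding arg e_def by (simp only: of_real_add distrib_left exp_add)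
    then show ?thesis by (simp only: S_def sum_distrib_left mult.left_commute)
  qed
  finally have lhs: "(\<integral>\<omega>. iexp (\<theta> * (C (Suc n) \<omega> \<bullet> v)) \<partial>M) = (\<integral>\<omega>. e \<omega> * S \<omega> \<partial>M)" .
  have S_bound: "cmod (S \<omega>) \<le> 1" if "\<omega> \<in> space M" for \<omega>
    using sum_norm_le[of UNIV "\<lambda>i. complex_of_real (share n i \<omega>) * iexp (\<theta> * D \<omega> i)" "\<lambda>i. share n i \<omega>"]
    by (simp add: S_def norm_mult share_nonneg that share_sum[OF that] del: of_real_mult)
  have int_eS: "integrable M (\<lambda>\<omega>. e \<omega> * S \<omega>)"
    by (rule integrable_bounded[of _ 1]) (auto simp: norm_mult S_bound)
  have int_e: "integrable M (\<lambda>\<omega>. g * e \<omega>)"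
    by (rule integrable_bounded[of _ "cmod g"]) (auto simp: norm_mult)
  have int_v: "integrable M (\<lambda>\<omega>. \<bar>l\<^sup>2 * draw_variance v n \<omega> - q\<bar>)"
  proof (rule integrable_bounded[of _ "l\<^sup>2 * (2 * norm v)\<^sup>2 + q"])
    fix \<omega> assume "\<omega> \<in> space M"
    then have "\<bar>l\<^sup>2 * draw_variance v n \<omega>\<bar> \<le> l\<^sup>2 * (2 * norm v)\<^sup>2"
      using draw_variance_bound[of \<omega> v n] unfolding abs_mult by (auto intro!: mult_left_mono)
    then show "norm \<bar>l\<^sup>2 * draw_variance v n \<omega> - q\<bar> \<le> l\<^sup>2 * (2 * norm v)\<^sup>2 + q" using q by simp
  qed simp
  have pointwise: "cmod (e \<omega> * S \<omega> - g * e \<omega>) \<le> \<theta>\<^sup>2 / 2 * \<bar>l\<^sup>2 * draw_variance v n \<omega> - q\<bar> + b"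
    if w: "\<omega> \<in> space M" for \<omega>
  proof -
    let ?u = "l\<^sup>2 * draw_variance v n \<omega>"
    have u: "(\<Sum>i\<in>UNIV. share n i \<omega> * (D \<omega> i)\<^sup>2) = ?u"
      by (simp add: D_def draw_variance_def sum_distrib_left power_mult_distrib mult_ac)
    have "(\<Sum>i\<in>UNIV. share n i \<omega> * D \<omega> i) = l * ((\<Sum>i\<in>UNIV. share n i \<omega> * v $ i)
        - draw_mean v n \<omega> * (\<Sum>i\<in>UNIV. share n i \<omega>))"
      by (simp add: D_def sum_distrib_left sum_subtractf algebra_simps)
    also have "\<dots> = 0" by (simp add: share_sum[OF w] draw_mean_def)
    finally have centred: "(\<Sum>i\<in>UNIV. share n i \<omega> * D \<omega> i) = 0" .
    have D: "\<bar>D \<omega> i\<bar> \<le> 2 * \<bar>l\<bar> * norm v" for i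
    proof -
      have "\<bar>v $ i - draw_mean v n \<omega>\<bar> \<le> 2 * norm v"
        using draw_mean_bound[OF w, of v n] component_le_norm_cart[of v i] by linarith
      then show ?thesis using mult_left_mono[of _ _ "\<bar>l\<bar>"] by (fastforce simp: D_def abs_mult)
    qed
    have 1: "cmod (S \<omega> - of_real (1 - \<theta>\<^sup>2 / 2 * ?u)) \<le> (\<bar>\<theta>\<bar> * (2 * \<bar>l\<bar> * norm v)) ^ 3"
      using weighted_iexp_expansion[of "\<lambda>i. share n i \<omega>" "D \<omega>" _ \<theta>, OF share_nonneg[OF w]
          share_sum[OF w] centred D] unfolding u S_def .
    have 2: "cmod (g - of_real (1 - \<theta>\<^sup>2 / 2 * q)) \<le> (\<bar>\<theta>\<bar> * sqrt q) ^ 3"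
      using exp_minus_expansion[of "\<bar>\<theta>\<bar> * sqrt q"] q
      unfolding g_def of_real_diff[symmetric] norm_of_real by (simp add: power_mult_distrib)
    have 3: "cmod (of_real (1 - \<theta>\<^sup>2 / 2 * ?u) - of_real (1 - \<theta>\<^sup>2 / 2 * q)) = \<theta>\<^sup>2 / 2 * \<bar>?u - q\<bar>"
    proof -
      have "(1 - \<theta>\<^sup>2 / 2 * ?u) - (1 - \<theta>\<^sup>2 / 2 * q) = \<theta>\<^sup>2 / 2 * (q - ?u)" by (simp add: algebra_simps)
      then show ?thesis unfolding of_real_diff[symmetric] norm_of_real
        by (simp only: abs_mult abs_minus_commute) simp
    qed
    have "cmod (e \<omega> * S \<omega> - g * e \<omega>) = cmod (S \<omega> - g)"
      by (metis mult.commute norm_mult ne mult_1 right_diff_distrib)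
    also have "\<dots> \<le> cmod (S \<omega> - of_real (1 - \<theta>\<^sup>2 / 2 * ?u))
        + cmod (of_real (1 - \<theta>\<^sup>2 / 2 * ?u) - of_real (1 - \<theta>\<^sup>2 / 2 * q))
        + cmod (g - of_real (1 - \<theta>\<^sup>2 / 2 * q))"
      by (smt (verit, ccfv_threshold) norm_minus_commute norm_triangle_ineq diff_add_cancel add_diff_eq)
    also have "\<dots> \<le> \<theta>\<^sup>2 / 2 * \<bar>?u - q\<bar> + b"
      using 1 2 3 by (simp add: b_def power_mult_distrib algebra_simps)
    finally show ?thesis .
  qed
  have "cmod ((\<integral>\<omega>. e \<omega> * S \<omega> \<partial>M) - g * (\<integral>\<omega>. e \<omega> \<partial>M)) = cmod (\<integral>\<omega>. (e \<omega> * S \<omega> - g * e \<omega>) \<partial>M)"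
    using int_eS int_e by simp
  also have "\<dots> \<le> (\<integral>\<omega>. cmod (e \<omega> * S \<omega> - g * e \<omega>) \<partial>M)" by (rule integral_norm_bound)
  also have "\<dots> \<le> (\<integral>\<omega>. \<theta>\<^sup>2 / 2 * \<bar>l\<^sup>2 * draw_variance v n \<omega> - q\<bar> + b \<partial>M)"
    using int_eS int_e int_v pointwise by (intro integral_mono) auto
  also have "\<dots> = \<theta>\<^sup>2 / 2 * (\<integral>\<omega>. \<bar>l\<^sup>2 * draw_variance v n \<omega> - q\<bar> \<partial>M) + b"
    using int_v by (simp add: prob_space)
  finally show ?thesis unfolding lhs g_def b_def e_def Y_def .
qed

text \<open>
  Iteration of \<open>characteristic_step\<close> down to the deterministic initial composition. The induction runs
  over all arguments \<open>\<theta>\<close> at once because each step changes the argument; the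
  Gaussian factor is at most \<open>1\<close>, so it does not amplify the errors made at earlier times.
\<close>

lemma characteristic_expansion:
  fixes v l q
  defines "T \<equiv> affine_rec (\<lambda>n. (1 + l / real (Suc n))\<^sup>2) (\<lambda>n. 1)"
    and "E \<equiv> affine_rec (\<lambda>n. (1 + l / real (Suc n))\<^sup>2) (\<lambda>n. \<integral>\<omega>. \<bar>l\<^sup>2 * draw_variance v n \<omega> - q\<bar> \<partial>M)"
    and "H \<equiv> affine_rec (\<lambda>n. (1 + l / real (Suc n)) ^ 3) (\<lambda>n. 1)"
    and "K \<equiv> (2 * \<bar>l\<bar> * norm v) ^ 3 + sqrt q ^ 3"
  assumes eig: "R *v v = l *s v" and q: "0 \<le> q" and l: "- 1 \<le> l"
  shows "cmod ((\<integral>\<omega>. iexp (\<theta> * (C n \<omega> \<bullet> v)) \<partial>M)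
           - of_real (exp (- (\<theta>\<^sup>2 * q / 2 * T n))) * iexp (\<theta> * urn_Pi n l * (C0 \<bullet> v)))
         \<le> \<theta>\<^sup>2 / 2 * E n + K * (\<bar>\<theta>\<bar> ^ 3 * H n)"
proof (induction n arbitrary: \<theta>)
  case 0
  have "(\<integral>\<omega>. iexp (\<theta> * (C 0 \<omega> \<bullet> v)) \<partial>M) = (\<integral>\<omega>. iexp (\<theta> * (C0 \<bullet> v)) \<partial>M)"
    by (rule Bochner_Integration.integral_cong) (simp_all add: initial)
  then show ?case by (simp add: T_def E_def H_def prob_space)
next
  case (Suc n)
  define r where "r = 1 + l / real (Suc n)"
  have r: "0 \<le> r" using l by (simp add: r_def field_simps)
  define \<epsilon> where "\<epsilon> = (\<integral>\<omega>. \<bar>l\<^sup>2 * draw_variance v n \<omega> - q\<bar> \<partial>M)"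
  define g where "g = complex_of_real (exp (- (\<theta>\<^sup>2 * q / 2)))"
  define \<phi> where "\<phi> = (\<integral>\<omega>. iexp (\<theta> * (C (Suc n) \<omega> \<bullet> v)) \<partial>M)"
  define \<psi> where "\<psi> = (\<integral>\<omega>. iexp (\<theta> * r * (C n \<omega> \<bullet> v)) \<partial>M)"
  define \<kappa> where "\<kappa> = complex_of_real (exp (- ((\<theta> * r)\<^sup>2 * q / 2 * T n))) * iexp (\<theta> * r * urn_Pi n l * (C0 \<bullet> v))"
  have T: "T (Suc n) = r\<^sup>2 * T n + 1" and E: "E (Suc n) = r\<^sup>2 * E n + \<epsilon>"
    and H: "H (Suc n) = r ^ 3 * H n + 1"
    by (simp_all add: T_def E_def H_def r_def \<epsilon>_def)
  have "cmod (g * \<psi> - g * \<kappa>) = exp (- (\<theta>\<^sup>2 * q / 2)) * cmod (\<psi> - \<kappa>)"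
    by (simp add: g_def norm_mult flip: right_diff_distrib)
  also have "\<dots> \<le> 1 * cmod (\<psi> - \<kappa>)" using q by (intro mult_right_mono) auto
  also have "\<dots> \<le> (\<theta> * r)\<^sup>2 / 2 * E n + K * (\<bar>\<theta> * r\<bar> ^ 3 * H n)"
    using Suc.IH[of "\<theta> * r"] by (simp add: \<psi>_def \<kappa>_def)
  finally have 1: "cmod (g * \<psi> - g * \<kappa>) \<le> (\<theta> * r)\<^sup>2 / 2 * E n + K * (\<bar>\<theta> * r\<bar> ^ 3 * H n)" .
  have 2: "cmod (\<phi> - g * \<psi>) \<le> \<theta>\<^sup>2 / 2 * \<epsilon> + K * \<bar>\<theta>\<bar> ^ 3"
    using characteristic_step[OF eig q, of \<theta> n]
    by (simp add: \<phi>_def \<psi>_def g_def \<epsilon>_def K_def r_def)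
  have "\<theta>\<^sup>2 * q / 2 * T (Suc n) = \<theta>\<^sup>2 * q / 2 + (\<theta> * r)\<^sup>2 * q / 2 * T n"
    by (simp add: T power_mult_distrib algebra_simps)
  then have "exp (- (\<theta>\<^sup>2 * q / 2 * T (Suc n)))
      = exp (- (\<theta>\<^sup>2 * q / 2)) * exp (- ((\<theta> * r)\<^sup>2 * q / 2 * T n))"
    by (simp only: minus_add_distrib exp_add)
  moreover have "\<theta> * r * urn_Pi n l = \<theta> * urn_Pi (Suc n) l"
    by (simp add: r_def)
  ultimately have "g * \<kappa> = of_real (exp (- (\<theta>\<^sup>2 * q / 2 * T (Suc n))))
      * iexp (\<theta> * urn_Pi (Suc n) l * (C0 \<bullet> v))"
    unfolding g_def \<kappa>_def by (simp only: of_real_mult mult.assoc)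
  moreover have "cmod (\<phi> - g * \<kappa>) \<le> \<theta>\<^sup>2 / 2 * E (Suc n) + K * (\<bar>\<theta>\<bar> ^ 3 * H (Suc n))"
    using norm_triangle_ineq[of "\<phi> - g * \<psi>" "g * \<psi> - g * \<kappa>"] 1 2 r
    by (simp add: E H power_mult_distrib abs_mult algebra_simps)
  ultimately show ?case by (simp add: \<phi>_def)
qed

end

section \<open>Concentration of the conditional variance\<close>

context urn_model
begin

lemma expectation_composition_step:
  "(\<integral>\<omega>. C (Suc n) \<omega> $ j \<partial>M) = (\<integral>\<omega>. C n \<omega> $ j \<partial>M) + (\<Sum>i\<in>UNIV. R $ i $ j * (\<integral>\<omega>. share n i \<omega> \<partial>M))"
proof -
  have comp: "C n \<omega> $ j = real (Suc n) * share n j \<omega>" for \<omega> by (simp add: share_def)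
  have int: "integrable M (share n i)" for i
    by (rule integrable_bounded[of _ 1]) (auto simp: share_nonneg share_le_1)
  have "(\<integral>\<omega>. C (Suc n) \<omega> $ j \<partial>M) = (\<integral>\<omega>. C n \<omega> $ j + R $ X (Suc n) \<omega> $ j \<partial>M)"
    by (rule Bochner_Integration.integral_cong) (simp_all add: replacement)
  also have "\<dots> = (\<integral>\<omega>. (\<Sum>i\<in>UNIV. share n i \<omega> * (C n \<omega> $ j + R $ i $ j)) \<partial>M)"
  proof (rule expectation_draw_real[where H = "\<lambda>i \<omega>. C n \<omega> $ j + R $ i $ j"])
    fix i
    show "(\<lambda>\<omega>. C n \<omega> $ j + R $ i $ j) \<in> borel_measurable (natural_filtration M C n)"
      unfolding comp using share_adapted[of n n j] by simp
    fix \<omega> assume w: "\<omega> \<in> space M"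
    have 1: "\<bar>R $ i $ j\<bar> \<le> norm R"
      using component_le_norm_cart[of "R $ i" j] Finite_Cartesian_Product.norm_nth_le[of R i] by linarith
    have 2: "\<bar>C n \<omega> $ j\<bar> \<le> real (Suc n) * 1"
      unfolding comp abs_mult using w by (intro mult_mono) (auto simp: share_nonneg share_le_1)
    show "\<bar>C n \<omega> $ j + R $ i $ j\<bar> \<le> real (Suc n) * 1 + norm R"
      by (rule order_trans[OF abs_triangle_ineq add_mono[OF 2 1]])
  qed
  also have "\<dots> = (\<integral>\<omega>. C n \<omega> $ j + (\<Sum>i\<in>UNIV. R $ i $ j * share n i \<omega>) \<partial>M)"
    by (rule Bochner_Integration.integral_cong)
       (simp_all add: distrib_left sum.distrib mult.commute[of "share _ _ _"] share_sum flip: sum_distrib_left)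
  also have "\<dots> = (\<integral>\<omega>. C n \<omega> $ j \<partial>M) + (\<Sum>i\<in>UNIV. R $ i $ j * (\<integral>\<omega>. share n i \<omega> \<partial>M))"
    unfolding comp using int by simp
  finally show ?thesis .
qed

lemma expectation_share: "(\<integral>\<omega>. share n i \<omega> \<partial>M) = (\<integral>\<omega>. C n \<omega> $ i \<partial>M) / real (Suc n)"
  by (simp add: share_def)

text \<open>
  A color that no other color produces has expected number \<open>x n\<close> with
  \<open>x (n + 1) = (1 + r / (n + 1)) * x n\<close>, where \<open>r = R $ a $ a\<close>; this grows like \<open>n powr r\<close>, slower than
  the total number of balls if \<open>r < 1\<close>.
\<close>

lemma expected_share_tendsto_0:
  assumes col: "\<And>j. j \<noteq> a \<Longrightarrow> R $ j $ a = 0" and r: "R $ a $ a < 1"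
  shows "(\<lambda>n. \<integral>\<omega>. share n a \<omega> \<partial>M) \<longlonglongrightarrow> 0"
proof -
  define r where "r = R $ a $ a"
  have r01: "0 \<le> r" "r < 1"
    using r replacement_stochastic by (auto simp: r_def stochastic_matrix_def prob_vector_def)
  \<comment> \<open>An exponent strictly between the growth rate \<open>r\<close> and the rate \<open>1\<close> of the scale.\<close>
  define g where "g = (1 + r) / 2"
  have g: "r < g" "g < 1" using r01 by (auto simp: g_def)
  define x where "x n = (\<integral>\<omega>. C n \<omega> $ a \<partial>M)" for n
  have "x (Suc n) = (1 + r / real (Suc n)) * x n + 0" for n
  proof -
    have "(\<Sum>i\<in>UNIV. R $ i $ a * (\<integral>\<omega>. share n i \<omega> \<partial>M)) = r * (\<integral>\<omega>. share n a \<omega> \<partial>M)"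
      using sum.remove[of UNIV a "\<lambda>i. R $ i $ a * (\<integral>\<omega>. share n i \<omega> \<partial>M)"] col by (simp add: r_def)
    then show ?thesis
      unfolding x_def expectation_composition_step expectation_share by (simp add: distrib_right)
  qed
  then have "(\<lambda>n. x n / real n) \<longlonglongrightarrow> 0 / (1 - r)"
  proof (rule recurrence_limit[where w = "\<lambda>n. real n powr g"])
    show "(\<lambda>n. real (Suc n) - (1 + r / real (Suc n)) * real n) \<longlonglongrightarrow> 1 - r" by real_asymp
    show "\<forall>\<^sub>F n in sequentially. (1 + r / real (Suc n)) * real n powr g \<le> real (Suc n) powr g"
      using g by real_asymp
    show "(\<lambda>n. real n powr g / real n) \<longlonglongrightarrow> 0" using g by real_asymp
    show "\<forall>\<^sub>F n in sequentially. 0 < real n powr g" by real_asymp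
    show "\<forall>\<^sub>F n in sequentially. 0 < real n" by real_asymp
  qed (use r01 in auto)
  then have "(\<lambda>n. x n / real n * (real n / real (Suc n))) \<longlonglongrightarrow> 0 / (1 - r) * 1"
    by (rule tendsto_mult) real_asymp
  then have "(\<lambda>n. x n / real n * (real n / real (Suc n))) \<longlonglongrightarrow> 0" by simp
  then show ?thesis
  proof (rule Lim_transform_eventually)
    show "\<forall>\<^sub>F n in sequentially. x n / real n * (real n / real (Suc n)) = (\<integral>\<omega>. share n a \<omega> \<partial>M)"
      using eventually_gt_at_top[of 0] by eventually_elim (simp add: x_def expectation_share)
  qed
qed

lemma second_moment_step:
  assumes eig: "R *v v = l *s v"
  shows "(\<integral>\<omega>. (C (Suc n) \<omega> \<bullet> v)\<^sup>2 \<partial>M)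
      \<le> (1 + 2 * l / real (Suc n)) * (\<integral>\<omega>. (C n \<omega> \<bullet> v)\<^sup>2 \<partial>M) + l\<^sup>2 * (norm v)\<^sup>2"
proof -
  define Y where "Y \<omega> = C n \<omega> \<bullet> v" for \<omega>
  have [measurable]: "Y \<in> borel_measurable M" unfolding Y_def by measurable
  have Ymean: "draw_mean v n \<omega> = Y \<omega> / real (Suc n)" for \<omega>
    by (simp add: Y_def draw_mean_def inner_composition)
  have Y_bound: "\<bar>Y \<omega>\<bar> \<le> real (Suc n) * norm v" if "\<omega> \<in> space M" for \<omega>
    using inner_composition_bound[OF that] by (simp add: Y_def)
  have int: "integrable M (\<lambda>\<omega>. (Y \<omega>)\<^sup>2)"
    by (rule integrable_bounded[of _ "(real (Suc n) * norm v)\<^sup>2"])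
       (use power_mono[OF Y_bound, of _ 2] in auto)
  have v2: "\<bar>(v $ i)\<^sup>2\<bar> \<le> (norm v)\<^sup>2" for i
    using power_mono[OF component_le_norm_cart[of v i], of 2] by simp
  have int2: "integrable M (\<lambda>\<omega>. \<Sum>i\<in>UNIV. share n i \<omega> * (v $ i)\<^sup>2)"
    by (rule integrable_bounded[of _ "(norm v)\<^sup>2"]) (auto intro!: share_average_le v2)
  have "(\<integral>\<omega>. (C (Suc n) \<omega> \<bullet> v)\<^sup>2 \<partial>M) = (\<integral>\<omega>. (Y \<omega> + l * v $ X (Suc n) \<omega>)\<^sup>2 \<partial>M)"
    by (rule Bochner_Integration.integral_cong) (simp_all add: Y_def eigenvector_increment[OF eig])
  also have "\<dots> = (\<integral>\<omega>. (\<Sum>i\<in>UNIV. share n i \<omega> * (Y \<omega> + l * v $ i)\<^sup>2) \<partial>M)"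
  proof (rule expectation_draw_real[where H = "\<lambda>i \<omega>. (Y \<omega> + l * v $ i)\<^sup>2"])
    fix i
    note [measurable] = composition_adapted[OF order_refl, of n]
    show "(\<lambda>\<omega>. (Y \<omega> + l * v $ i)\<^sup>2) \<in> borel_measurable (natural_filtration M C n)"
      unfolding Y_def by measurable
    fix \<omega> assume w: "\<omega> \<in> space M"
    have "\<bar>Y \<omega> + l * v $ i\<bar> \<le> real (Suc n) * norm v + \<bar>l\<bar> * norm v"
      by (rule order_trans[OF abs_triangle_ineq add_mono[OF Y_bound[OF w]]])
         (simp add: abs_mult mult_left_mono component_le_norm_cart)
    from power_mono[OF this, of 2]
    show "\<bar>(Y \<omega> + l * v $ i)\<^sup>2\<bar> \<le> (real (Suc n) * norm v + \<bar>l\<bar> * norm v)\<^sup>2" by simp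
  qed
  also have "\<dots> = (\<integral>\<omega>. (1 + 2 * l / real (Suc n)) * (Y \<omega>)\<^sup>2
      + l\<^sup>2 * (\<Sum>i\<in>UNIV. share n i \<omega> * (v $ i)\<^sup>2) \<partial>M)"
  proof (rule Bochner_Integration.integral_cong[OF refl])
    fix \<omega> assume w: "\<omega> \<in> space M"
    have "(\<Sum>i\<in>UNIV. share n i \<omega> * (Y \<omega> + l * v $ i)\<^sup>2)
        = (Y \<omega>)\<^sup>2 * (\<Sum>i\<in>UNIV. share n i \<omega>) + 2 * l * Y \<omega> * draw_mean v n \<omega>
          + l\<^sup>2 * (\<Sum>i\<in>UNIV. share n i \<omega> * (v $ i)\<^sup>2)"
      unfolding draw_mean_def
      by (simp add: power2_sum power_mult_distrib sum.distrib sum_distrib_left sum_distrib_right algebra_simps)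
    then show "(\<Sum>i\<in>UNIV. share n i \<omega> * (Y \<omega> + l * v $ i)\<^sup>2)
        = (1 + 2 * l / real (Suc n)) * (Y \<omega>)\<^sup>2 + l\<^sup>2 * (\<Sum>i\<in>UNIV. share n i \<omega> * (v $ i)\<^sup>2)"
      using share_sum[OF w, of n] by (simp add: Ymean power2_eq_square distrib_right)
  qed
  also have "\<dots> = (1 + 2 * l / real (Suc n)) * (\<integral>\<omega>. (Y \<omega>)\<^sup>2 \<partial>M)
      + l\<^sup>2 * (\<integral>\<omega>. (\<Sum>i\<in>UNIV. share n i \<omega> * (v $ i)\<^sup>2) \<partial>M)"
    using int int2 by (simp only: Bochner_Integration.integral_add integrable_mult_right integral_mult_right_zero)
  also have "(\<integral>\<omega>. (\<Sum>i\<in>UNIV. share n i \<omega> * (v $ i)\<^sup>2) \<partial>M) \<le> (\<integral>\<omega>. (norm v)\<^sup>2 \<partial>M)"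
    using int2 by (intro integral_mono abs_le_D1[OF share_average_le[OF _ v2]]) auto
  finally show ?thesis by (simp add: Y_def prob_space mult_left_mono)
qed

text \<open>
  By \<open>second_moment_step\<close> with \<open>2 * l \<le> 1\<close>, the second moment of \<open>C n \<bullet> v\<close> grows at most like
  \<open>n * ln n\<close>, whereas \<open>draw_mean\<close> divides it by \<open>(n + 1)\<^sup>2\<close>. The first absolute moment follows by
  Cauchy-Schwarz, in the form that a variance is nonnegative.
\<close>

lemma draw_mean_tendsto_0:
  assumes eig: "R *v v = l *s v" and l: "l \<le> 1 / 2"
  shows "(\<lambda>n. \<integral>\<omega>. (draw_mean v n \<omega>)\<^sup>2 \<partial>M) \<longlonglongrightarrow> 0"
    and "(\<lambda>n. \<integral>\<omega>. \<bar>draw_mean v n \<omega>\<bar> \<partial>M) \<longlonglongrightarrow> 0"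
proof -
  define x where "x n = (\<integral>\<omega>. (C n \<omega> \<bullet> v)\<^sup>2 \<partial>M)" for n
  define K where "K = l\<^sup>2 * (norm v)\<^sup>2"
  have x0: "0 \<le> x n" for n unfolding x_def by simp
  have step: "x (Suc n) \<le> (1 + 1 / real (Suc n)) * x n + K" for n
  proof -
    have "2 * l / real (Suc n) \<le> 1 / real (Suc n)" using l by (intro divide_right_mono) auto
    then have "(1 + 2 * l / real (Suc n)) * x n \<le> (1 + 1 / real (Suc n)) * x n"
      using x0 by (intro mult_right_mono) auto
    with second_moment_step[OF eig, of n] show ?thesis by (simp add: x_def K_def)
  qed
  have "(\<lambda>n. x n / (real n)\<^sup>2) \<longlonglongrightarrow> 0"
  proof (rule recurrence_negligible[where d = x and w = real, OF step x0])
    show "\<forall>\<^sub>F n in sequentially. 0 < (real (Suc n))\<^sup>2 - (1 + 1 / real (Suc n)) * (real n)\<^sup>2"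
      by real_asymp
    show "(\<lambda>n. K / ((real (Suc n))\<^sup>2 - (1 + 1 / real (Suc n)) * (real n)\<^sup>2)) \<longlonglongrightarrow> 0"
      by real_asymp
    show "\<forall>\<^sub>F n in sequentially. (1 + 1 / real (Suc n)) * real n \<le> real (Suc n)" by real_asymp
    show "(\<lambda>n. real n / (real n)\<^sup>2) \<longlonglongrightarrow> 0" by real_asymp
    show "\<forall>\<^sub>F n in sequentially. 0 < (real n)\<^sup>2" by real_asymp
    show "\<forall>\<^sub>F n in sequentially. 0 < real n" by real_asymp
  qed simp
  then have "(\<lambda>n. x n / (real n)\<^sup>2 * (real n / real (Suc n))\<^sup>2) \<longlonglongrightarrow> 0 * 1"
    by (rule tendsto_mult) real_asymp
  then have lim: "(\<lambda>n. x n / (real n)\<^sup>2 * (real n / real (Suc n))\<^sup>2) \<longlonglongrightarrow> 0" by simp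
  have mean: "draw_mean v n \<omega> = (C n \<omega> \<bullet> v) / real (Suc n)" for n \<omega>
    by (simp add: draw_mean_def inner_composition)
  show sq: "(\<lambda>n. \<integral>\<omega>. (draw_mean v n \<omega>)\<^sup>2 \<partial>M) \<longlonglongrightarrow> 0"
    using lim
  proof (rule Lim_transform_eventually)
    show "\<forall>\<^sub>F n in sequentially. x n / (real n)\<^sup>2 * (real n / real (Suc n))\<^sup>2
        = (\<integral>\<omega>. (draw_mean v n \<omega>)\<^sup>2 \<partial>M)"
      using eventually_gt_at_top[of 0]
      by eventually_elim (simp add: x_def mean power_divide)
  qed
  have int: "integrable M (\<lambda>\<omega>. \<bar>draw_mean v n \<omega>\<bar>)" for n
    by (rule integrable_bounded[of _ "norm v"]) (auto simp: draw_mean_bound)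
  have int2: "integrable M (\<lambda>\<omega>. \<bar>draw_mean v n \<omega>\<bar>\<^sup>2)" for n
    by (rule integrable_bounded[of _ "(norm v)\<^sup>2"])
       (use power_mono[OF draw_mean_bound, of _ v n 2] in auto)
  have bound: "norm (\<integral>\<omega>. \<bar>draw_mean v n \<omega>\<bar> \<partial>M) \<le> sqrt (\<integral>\<omega>. (draw_mean v n \<omega>)\<^sup>2 \<partial>M)" for n
    using variance_positive[of "\<lambda>\<omega>. \<bar>draw_mean v n \<omega>\<bar>"] variance_eq[OF int int2, of n]
    by (intro real_le_rsqrt) simp
  have "(\<lambda>n. sqrt (\<integral>\<omega>. (draw_mean v n \<omega>)\<^sup>2 \<partial>M)) \<longlonglongrightarrow> 0"
    using tendsto_real_sqrt[OF sq] by simp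
  with bound show "(\<lambda>n. \<integral>\<omega>. \<bar>draw_mean v n \<omega>\<bar> \<partial>M) \<longlonglongrightarrow> 0"
    by (rule Lim_null_comparison[OF always_eventually[OF allI]])
qed

text \<open>
  The identity for the squared coordinates writes the conditional variance as \<open>q0\<close> plus multiples of
  \<open>draw_mean\<close>, of its square, and of the share of the color \<open>a\<close>. All three
  quantities tend to \<open>0\<close> in \<open>L\<^sup>1\<close>.
\<close>

lemma draw_variance_tendsto:
  assumes eig: "R *v v = l *s v" and l: "l \<le> 1 / 2"
    and square: "\<And>j. (v $ j)\<^sup>2 = \<alpha> * v $ j + q0 + (if j = a then \<delta> else 0)"
    and col: "\<And>j. j \<noteq> a \<Longrightarrow> R $ j $ a = 0" and r: "R $ a $ a < 1"
  shows "(\<lambda>n. \<integral>\<omega>. \<bar>l\<^sup>2 * draw_variance v n \<omega> - l\<^sup>2 * q0\<bar> \<partial>M) \<longlonglongrightarrow> 0"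
proof -
  let ?m = "draw_mean v"
  let ?b = "\<lambda>n \<omega>. l\<^sup>2 * (\<bar>\<alpha>\<bar> * \<bar>?m n \<omega>\<bar> + \<bar>\<delta>\<bar> * share n a \<omega> + (?m n \<omega>)\<^sup>2)"
  have int: "integrable M (\<lambda>\<omega>. \<bar>?m n \<omega>\<bar>)" for n
    by (rule integrable_bounded[of _ "norm v"]) (auto simp: draw_mean_bound)
  have int2: "integrable M (\<lambda>\<omega>. (?m n \<omega>)\<^sup>2)" for n
    by (rule integrable_bounded[of _ "(norm v)\<^sup>2"])
       (use power_mono[OF draw_mean_bound, of _ v n 2] in auto)
  have ints: "integrable M (share n a)" for n
    by (rule integrable_bounded[of _ 1]) (auto simp: share_nonneg share_le_1)
  have le: "\<bar>l\<^sup>2 * draw_variance v n \<omega> - l\<^sup>2 * q0\<bar> \<le> ?b n \<omega>" if w: "\<omega> \<in> space M" for n \<omega>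
  proof -
    have "(\<Sum>i\<in>UNIV. share n i \<omega> * (v $ i)\<^sup>2)
        = \<alpha> * ?m n \<omega> + q0 * (\<Sum>i\<in>UNIV. share n i \<omega>) + \<delta> * share n a \<omega>"
      unfolding square draw_mean_def
    proof -
      have "share n i \<omega> * (\<alpha> * v $ i + q0 + (if i = a then \<delta> else 0))
          = \<alpha> * (share n i \<omega> * v $ i) + q0 * share n i \<omega> + (if i = a then \<delta> * share n i \<omega> else 0)" for i
        by (simp add: algebra_simps)
      then show "(\<Sum>i\<in>UNIV. share n i \<omega> * (\<alpha> * v $ i + q0 + (if i = a then \<delta> else 0)))
          = \<alpha> * (\<Sum>i\<in>UNIV. share n i \<omega> * v $ i) + q0 * (\<Sum>i\<in>UNIV. share n i \<omega>) + \<delta> * share n a \<omega>"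
        by (simp add: sum.distrib sum_distrib_left)
    qed
    then have "l\<^sup>2 * draw_variance v n \<omega> - l\<^sup>2 * q0 = l\<^sup>2 * (\<alpha> * ?m n \<omega> + \<delta> * share n a \<omega> - (?m n \<omega>)\<^sup>2)"
      unfolding draw_variance_eq[OF w] using share_sum[OF w, of n] by (simp add: algebra_simps)
    moreover have "\<bar>\<alpha> * ?m n \<omega> + \<delta> * share n a \<omega> - (?m n \<omega>)\<^sup>2\<bar>
        \<le> \<bar>\<alpha> * ?m n \<omega>\<bar> + \<bar>\<delta> * share n a \<omega>\<bar> + \<bar>(?m n \<omega>)\<^sup>2\<bar>" by linarith
    ultimately show ?thesis
      using share_nonneg[OF w, of n a] by (simp add: abs_mult mult_left_mono)
  qed
  have int_b: "integrable M (?b n)" for n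
    using int[of n] int2[of n] ints[of n] by simp
  have int_d: "integrable M (\<lambda>\<omega>. \<bar>l\<^sup>2 * draw_variance v n \<omega> - l\<^sup>2 * q0\<bar>)" for n
  proof (rule Bochner_Integration.integrable_bound[OF int_b[of n]])
    show "AE \<omega> in M. norm \<bar>l\<^sup>2 * draw_variance v n \<omega> - l\<^sup>2 * q0\<bar> \<le> norm (?b n \<omega>)"
      unfolding real_norm_def abs_abs by (intro AE_I2 order_trans[OF le abs_ge_self])
  qed simp
  have "(\<lambda>n. l\<^sup>2 * (\<bar>\<alpha>\<bar> * (\<integral>\<omega>. \<bar>?m n \<omega>\<bar> \<partial>M) + \<bar>\<delta>\<bar> * (\<integral>\<omega>. share n a \<omega> \<partial>M) + (\<integral>\<omega>. (?m n \<omega>)\<^sup>2 \<partial>M)))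
      \<longlonglongrightarrow> l\<^sup>2 * (\<bar>\<alpha>\<bar> * 0 + \<bar>\<delta>\<bar> * 0 + 0)"
    by (intro tendsto_intros draw_mean_tendsto_0[OF eig l] expected_share_tendsto_0[OF col r])
  moreover have "(\<integral>\<omega>. ?b n \<omega> \<partial>M) = l\<^sup>2 * (\<bar>\<alpha>\<bar> * (\<integral>\<omega>. \<bar>?m n \<omega>\<bar> \<partial>M)
      + \<bar>\<delta>\<bar> * (\<integral>\<omega>. share n a \<omega> \<partial>M) + (\<integral>\<omega>. (?m n \<omega>)\<^sup>2 \<partial>M))" for n
    using int[of n] int2[of n] ints[of n] by simp
  ultimately have lim: "(\<lambda>n. \<integral>\<omega>. ?b n \<omega> \<partial>M) \<longlonglongrightarrow> 0"
    by (simp only: mult_zero_right add_0)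
  have "norm (\<integral>\<omega>. \<bar>l\<^sup>2 * draw_variance v n \<omega> - l\<^sup>2 * q0\<bar> \<partial>M) \<le> (\<integral>\<omega>. ?b n \<omega> \<partial>M)" for n
    using integral_mono[OF int_d int_b le, of n] by simp
  then show ?thesis
    using lim by (rule Lim_null_comparison[OF always_eventually[OF allI]])
qed

end

section \<open>Central limit theorems\<close>

context urn_model
begin

text \<open>
  With \<open>\<theta> = t / sqrt (s n)\<close> in \<open>characteristic_expansion\<close>, the exponent converges because the sum of
  the squared weights is asymptotic to \<open>s n / \<beta>\<close>, both error terms vanish, and so does the influence
  of the initial composition. The scale \<open>s\<close> enters through the asymptotic inequalities only, which is
  why both regimes are instances.
\<close>

lemma clt_of_recurrences:
  assumes eig: "R *v v = l *s v" and q: "0 \<le> q" and l: "- 1 \<le> l"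
    and variance: "(\<lambda>n. \<integral>\<omega>. \<bar>l\<^sup>2 * draw_variance v n \<omega> - q\<bar> \<partial>M) \<longlonglongrightarrow> 0"
    and s: "eventually (\<lambda>n. 0 < s n) sequentially"
    and gap: "(\<lambda>n. s (Suc n) - (1 + l / real (Suc n))\<^sup>2 * s n) \<longlonglongrightarrow> \<beta>" and \<beta>: "0 < \<beta>"
    and w: "eventually (\<lambda>n. 0 < w n) sequentially"
           "eventually (\<lambda>n. (1 + l / real (Suc n))\<^sup>2 * w n \<le> w (Suc n)) sequentially"
    and ws: "(\<lambda>n. w n / s n) \<longlonglongrightarrow> 0"
    and cubic: "(\<lambda>n. affine_rec (\<lambda>n. (1 + l / real (Suc n)) ^ 3) (\<lambda>n. 1) n / s n powr (3/2)) \<longlonglongrightarrow> 0"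
  shows "weak_conv_m (\<lambda>n. distr M borel (\<lambda>\<omega>. (C n \<omega> \<bullet> v) / sqrt (s n))) (normal_law 0 (q / \<beta>))"
proof (rule levy_continuity)
  show "real_distribution (distr M borel (\<lambda>\<omega>. (C n \<omega> \<bullet> v) / sqrt (s n)))" for n
    by (rule real_distribution_distr) simp
  show "real_distribution (normal_law 0 (q / \<beta>))"
    using q \<beta> by (intro real_distribution_normal_law) simp
  fix t
  define A where "A n = (1 + l / real (Suc n))\<^sup>2" for n
  define \<epsilon> where "\<epsilon> n = (\<integral>\<omega>. \<bar>l\<^sup>2 * draw_variance v n \<omega> - q\<bar> \<partial>M)" for n
  define T where "T = affine_rec A (\<lambda>n. 1)"
  define E where "E = affine_rec A \<epsilon>"
  define H where "H = affine_rec (\<lambda>n. (1 + l / real (Suc n)) ^ 3) (\<lambda>n. 1)"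
  define K where "K = (2 * \<bar>l\<bar> * norm v) ^ 3 + sqrt q ^ 3"
  define \<theta> where "\<theta> n = t / sqrt (s n)" for n
  note limit = recurrence_limit[where A = A and s = s and w = w, OF _ _ s _ \<beta> _ w(1) _ ws]
  have A0: "0 \<le> A n" for n by (simp add: A_def)
  have T: "(\<lambda>n. T n / s n) \<longlonglongrightarrow> 1 / \<beta>"
    by (rule limit) (use gap w(2) in \<open>auto simp: T_def A_def\<close>)
  have "(\<lambda>n. E n / s n) \<longlonglongrightarrow> 0 / \<beta>"
    by (rule limit[where c = \<epsilon>]) (use gap w(2) variance in \<open>auto simp: E_def A_def \<epsilon>_def[abs_def]\<close>)
  then have E: "(\<lambda>n. E n / s n) \<longlonglongrightarrow> 0" by simp
  have "(\<lambda>n. (urn_Pi n l)\<^sup>2 / s n) \<longlonglongrightarrow> 0 / \<beta>"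
    by (rule limit[where c = "\<lambda>n. 0"]) (use gap w(2) in \<open>auto simp: A_def power_mult_distrib\<close>)
  then have "(\<lambda>n. \<bar>t\<bar> * sqrt ((urn_Pi n l)\<^sup>2 / s n)) \<longlonglongrightarrow> \<bar>t\<bar> * sqrt 0"
    by (intro tendsto_intros) simp
  moreover have "\<forall>\<^sub>F n in sequentially. \<bar>t\<bar> * sqrt ((urn_Pi n l)\<^sup>2 / s n) = \<bar>\<theta> n * urn_Pi n l\<bar>"
    using s by eventually_elim (simp add: \<theta>_def real_sqrt_divide abs_mult)
  ultimately have "(\<lambda>n. \<bar>\<theta> n * urn_Pi n l\<bar>) \<longlonglongrightarrow> \<bar>t\<bar> * sqrt 0"
    by (rule Lim_transform_eventually)
  then have "(\<lambda>n. \<bar>\<theta> n * urn_Pi n l\<bar>) \<longlonglongrightarrow> 0" by simp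
  then have start: "(\<lambda>n. \<theta> n * urn_Pi n l) \<longlonglongrightarrow> 0"
    by (rule tendsto_rabs_zero_cancel)
  have \<theta>2: "\<forall>\<^sub>F n in sequentially. (\<theta> n)\<^sup>2 = t\<^sup>2 / s n"
    using s by eventually_elim (simp add: \<theta>_def power_divide)
  have \<theta>3: "\<forall>\<^sub>F n in sequentially. \<bar>\<theta> n\<bar> ^ 3 = \<bar>t\<bar> ^ 3 / s n powr (3/2)"
    using s
  proof eventually_elim
    case (elim n)
    have "sqrt (s n) ^ 3 = s n powr (3/2)"
      using elim by (simp add: powr_half_sqrt[symmetric] powr_power)
    then show ?case using elim by (simp add: \<theta>_def power_divide)
  qed
  have "(\<lambda>n. t\<^sup>2 * q / 2 * (T n / s n)) \<longlonglongrightarrow> t\<^sup>2 * q / 2 * (1 / \<beta>)"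
    by (intro tendsto_intros T)
  then have exponent: "(\<lambda>n. (\<theta> n)\<^sup>2 * q / 2 * T n) \<longlonglongrightarrow> q / \<beta> * t\<^sup>2 / 2"
  proof (rule Lim_transform_eventually[THEN tendsto_eq_rhs])
    show "\<forall>\<^sub>F n in sequentially. t\<^sup>2 * q / 2 * (T n / s n) = (\<theta> n)\<^sup>2 * q / 2 * T n"
      using \<theta>2 by eventually_elim simp
  qed (simp add: mult_ac)
  have "(\<lambda>n. t\<^sup>2 / 2 * (E n / s n) + K * (\<bar>t\<bar> ^ 3 * (H n / s n powr (3/2))))
      \<longlonglongrightarrow> t\<^sup>2 / 2 * 0 + K * (\<bar>t\<bar> ^ 3 * 0)"
    by (intro tendsto_intros E cubic[folded H_def])
  then have error: "(\<lambda>n. (\<theta> n)\<^sup>2 / 2 * E n + K * (\<bar>\<theta> n\<bar> ^ 3 * H n)) \<longlonglongrightarrow> 0"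
  proof (rule Lim_transform_eventually[THEN tendsto_eq_rhs])
    show "\<forall>\<^sub>F n in sequentially. t\<^sup>2 / 2 * (E n / s n) + K * (\<bar>t\<bar> ^ 3 * (H n / s n powr (3/2)))
        = (\<theta> n)\<^sup>2 / 2 * E n + K * (\<bar>\<theta> n\<bar> ^ 3 * H n)"
      using \<theta>2 \<theta>3 by eventually_elim simp
  qed simp
  define G where "G n = complex_of_real (exp (- ((\<theta> n)\<^sup>2 * q / 2 * T n)))
      * iexp (\<theta> n * urn_Pi n l * (C0 \<bullet> v))" for n
  have "G \<longlonglongrightarrow> of_real (exp (- (q / \<beta> * t\<^sup>2 / 2))) * iexp (0 * (C0 \<bullet> v))"
    unfolding G_def by (intro tendsto_intros exponent start)
  then have G: "G \<longlonglongrightarrow> char (normal_law 0 (q / \<beta>)) t"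
    using q \<beta> by (simp add: char_normal_law)
  have char_eq: "char (distr M borel (\<lambda>\<omega>. (C n \<omega> \<bullet> v) / sqrt (s n))) t
      = (\<integral>\<omega>. iexp (\<theta> n * (C n \<omega> \<bullet> v)) \<partial>M)" for n
    by (simp add: char_def integral_distr \<theta>_def)
  have "(\<lambda>n. char (distr M borel (\<lambda>\<omega>. (C n \<omega> \<bullet> v) / sqrt (s n))) t - G n) \<longlonglongrightarrow> 0"
    using characteristic_expansion[OF eig q l]
    by (intro Lim_null_comparison[OF _ error] always_eventually allI)
       (simp only: char_eq G_def T_def E_def H_def K_def A_def[abs_def] \<epsilon>_def[abs_def])
  from tendsto_add[OF this G]
  show "(\<lambda>n. char (distr M borel (\<lambda>\<omega>. (C n \<omega> \<bullet> v) / sqrt (s n))) t)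
      \<longlonglongrightarrow> char (normal_law 0 (q / \<beta>)) t" by simp
qed

text \<open>
  The scale \<open>n\<close> has gap \<open>(n + 1) - (1 + l / (n + 1))\<^sup>2 * n\<close>, which tends to \<open>1 - 2 * l > 0\<close>. Powers
  \<open>n powr g\<close> with \<open>2 * l < g < 1\<close> are supersolutions of smaller order.
\<close>

lemma clt_subcritical:
  assumes eig: "R *v v = l *s v" and q: "0 \<le> q" and l: "- 1 \<le> l" "l < 1 / 2"
    and variance: "(\<lambda>n. \<integral>\<omega>. \<bar>l\<^sup>2 * draw_variance v n \<omega> - q\<bar> \<partial>M) \<longlonglongrightarrow> 0"
  shows "weak_conv_m (\<lambda>n. distr M borel (\<lambda>\<omega>. (C n \<omega> \<bullet> v) / sqrt (real n))) (normal_law 0 (q / (1 - 2 * l)))"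
proof -
  obtain g where g: "0 < g" "2 * l < g" "g < 1"
    using l dense[of "max 0 (2 * l)" 1] by auto
  have r: "0 \<le> 1 + l / real (Suc n)" for n using l by (simp add: field_simps)
  have cubic: "(\<lambda>n. affine_rec (\<lambda>n. (1 + l / real (Suc n)) ^ 3) (\<lambda>n. 1) n / real n powr (3/2)) \<longlonglongrightarrow> 0"
  proof (rule recurrence_negligible[where w = "\<lambda>n. real n powr (3 / 2 * g)" and \<delta> = "\<lambda>n. 1"])
    show "\<forall>\<^sub>F n in sequentially. 0 < real (Suc n) powr (3/2) - (1 + l / real (Suc n)) ^ 3 * real n powr (3/2)"
      using l by real_asymp
    show "(\<lambda>n. 1 / (real (Suc n) powr (3/2) - (1 + l / real (Suc n)) ^ 3 * real n powr (3/2))) \<longlonglongrightarrow> 0"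
      using l by real_asymp
    show "\<forall>\<^sub>F n in sequentially. (1 + l / real (Suc n)) ^ 3 * real n powr (3/2 * g) \<le> real (Suc n) powr (3/2 * g)"
      using g by real_asymp
    show "(\<lambda>n. real n powr (3/2 * g) / real n powr (3/2)) \<longlonglongrightarrow> 0" using g by real_asymp
    show "\<forall>\<^sub>F n in sequentially. 0 < real n powr (3/2)" by real_asymp
    show "\<forall>\<^sub>F n in sequentially. 0 < real n powr (3/2 * g)" by real_asymp
  qed (use r in \<open>auto intro!: affine_rec_nonneg zero_le_power simp del: of_nat_Suc\<close>)
  show ?thesis
  proof (rule clt_of_recurrences[OF eig q l(1) variance, where w = "\<lambda>n. real n powr g"])
    show "(\<lambda>n. real (Suc n) - (1 + l / real (Suc n))\<^sup>2 * real n) \<longlonglongrightarrow> 1 - 2 * l"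
      by real_asymp
    show "\<forall>\<^sub>F n in sequentially. (1 + l / real (Suc n))\<^sup>2 * real n powr g \<le> real (Suc n) powr g"
      using g by real_asymp
    show "(\<lambda>n. real n powr g / real n) \<longlonglongrightarrow> 0" using g by real_asymp
    show "\<forall>\<^sub>F n in sequentially. 0 < real n" by real_asymp
    show "\<forall>\<^sub>F n in sequentially. 0 < real n powr g" by real_asymp
  qed (use l cubic in auto)
qed

text \<open>
  At \<open>l = 1 / 2\<close> the gap of the scale \<open>n\<close> degenerates to \<open>0\<close>: \<open>n\<close> is itself a supersolution of the
  homogeneous recurrence. The scale \<open>n * ln n\<close> has gap tending to \<open>1\<close>.
\<close>

lemma clt_critical:
  assumes eig: "R *v v = (1 / 2) *s v" and q: "0 \<le> q"
    and variance: "(\<lambda>n. \<integral>\<omega>. \<bar>(1 / 2)\<^sup>2 * draw_variance v n \<omega> - q\<bar> \<partial>M) \<longlonglongrightarrow> 0"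
  shows "weak_conv_m (\<lambda>n. distr M borel (\<lambda>\<omega>. (C n \<omega> \<bullet> v) / sqrt (real n * ln (real n)))) (normal_law 0 q)"
proof -
  have cubic: "(\<lambda>n. affine_rec (\<lambda>n. (1 + 1 / 2 / real (Suc n)) ^ 3) (\<lambda>n. 1) n
      / (real n * ln (real n)) powr (3/2)) \<longlonglongrightarrow> 0"
  proof (rule recurrence_negligible[where w = "\<lambda>n. real n powr (3 / 2)" and \<delta> = "\<lambda>n. 1"])
    show "\<forall>\<^sub>F n in sequentially. 0 < (real (Suc n) * ln (real (Suc n))) powr (3/2)
        - (1 + 1 / 2 / real (Suc n)) ^ 3 * (real n * ln (real n)) powr (3/2)"
      by real_asymp
    show "(\<lambda>n. 1 / ((real (Suc n) * ln (real (Suc n))) powr (3/2)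
        - (1 + 1 / 2 / real (Suc n)) ^ 3 * (real n * ln (real n)) powr (3/2))) \<longlonglongrightarrow> 0"
      by real_asymp
    show "\<forall>\<^sub>F n in sequentially. (1 + 1 / 2 / real (Suc n)) ^ 3 * real n powr (3/2) \<le> real (Suc n) powr (3/2)"
      by real_asymp
    show "(\<lambda>n. real n powr (3/2) / (real n * ln (real n)) powr (3/2)) \<longlonglongrightarrow> 0" by real_asymp
    show "\<forall>\<^sub>F n in sequentially. 0 < (real n * ln (real n)) powr (3/2)" by real_asymp
    show "\<forall>\<^sub>F n in sequentially. 0 < real n powr (3/2)" by real_asymp
  qed (auto intro!: affine_rec_nonneg)
  have "weak_conv_m (\<lambda>n. distr M borel (\<lambda>\<omega>. (C n \<omega> \<bullet> v) / sqrt (real n * ln (real n)))) (normal_law 0 (q / 1))"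
  proof (rule clt_of_recurrences[OF eig q _ variance, where w = real])
    show "(\<lambda>n. real (Suc n) * ln (real (Suc n)) - (1 + 1 / 2 / real (Suc n))\<^sup>2 * (real n * ln (real n))) \<longlonglongrightarrow> 1"
      by real_asymp
    show "\<forall>\<^sub>F n in sequentially. (1 + 1 / 2 / real (Suc n))\<^sup>2 * real n \<le> real (Suc n)" by real_asymp
    show "(\<lambda>n. real n / (real n * ln (real n))) \<longlonglongrightarrow> 0" by real_asymp
    show "\<forall>\<^sub>F n in sequentially. 0 < real n * ln (real n)" by real_asymp
    show "\<forall>\<^sub>F n in sequentially. 0 < real n" by real_asymp
  qed (use cubic in auto)
  then show ?thesis by simp
qed

end

section \<open>The supercritical martingale\<close>

lemma urn_Pi_pos: "- 1 < l \<Longrightarrow> 0 < urn_Pi n l"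
proof (induction n)
  case (Suc n)
  have "0 < 1 + l / real (Suc n)" using Suc.prems by (simp add: field_simps)
  with Suc show ?case unfolding urn_Pi_Suc by (intro mult_pos_pos) auto
qed simp

text \<open>
  Up to the factor \<open>l * fact n\<close>, \<open>urn_Pi n l\<close> is the Pochhammer symbol in Gauss's product formula for
  \<open>Gamma l\<close>.
\<close>

lemma urn_Pi_asymptotics:
  assumes l: "0 < l"
  shows "(\<lambda>n. urn_Pi n l / real n powr l) \<longlonglongrightarrow> 1 / (l * Gamma l)"
proof -
  have poch: "pochhammer l (Suc n) = l * fact n * urn_Pi n l" for n
    by (induction n) (simp_all add: pochhammer_Suc field_simps)
  have "l * Gamma l \<noteq> 0" using l Gamma_real_pos[OF l] by (metis less_irrefl mult_pos_pos)
  then have "(\<lambda>n. 1 / (l * Gamma_series l n)) \<longlonglongrightarrow> 1 / (l * Gamma l)"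
    by (intro tendsto_intros Gamma_series_LIMSEQ)
  then show ?thesis
  proof (rule Lim_transform_eventually)
    show "\<forall>\<^sub>F n in sequentially. 1 / (l * Gamma_series l n) = urn_Pi n l / real n powr l"
      using eventually_gt_at_top[of 0]
    proof eventually_elim
      case (elim n)
      then show ?case using l urn_Pi_pos[of l n] poch[of n]
        by (simp add: Gamma_series_def powr_def)
    qed
  qed
qed

lemma summable_inverse_urn_Pi:
  assumes l: "1 / 2 < l"
  shows "summable (\<lambda>n. 1 / (urn_Pi (Suc n) l)\<^sup>2)"
proof -
  have "0 < l" using l by simp
  then have "1 / (l * Gamma l) \<noteq> 0"
    using Gamma_real_pos[of l] by (metis divide_eq_0_iff less_irrefl mult_pos_pos zero_neq_one)
  then have "(\<lambda>n. (1 / (urn_Pi n l / real n powr l))\<^sup>2) \<longlonglongrightarrow> (1 / (1 / (l * Gamma l)))\<^sup>2"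
    by (intro tendsto_power tendsto_divide[OF tendsto_const] urn_Pi_asymptotics \<open>0 < l\<close>)
  then have "Bseq (\<lambda>n. (1 / (urn_Pi n l / real n powr l))\<^sup>2)"
    by (intro convergent_imp_Bseq convergentI)
  then obtain B where B: "\<And>n. norm ((1 / (urn_Pi n l / real n powr l))\<^sup>2) \<le> B"
    by (auto simp: Bseq_def)
  have "summable (\<lambda>n. B * real n powr (- 2 * l))"
    using l by (intro summable_mult) (simp add: summable_real_powr_iff)
  then have "summable (\<lambda>n. 1 / (urn_Pi n l)\<^sup>2)"
  proof (rule summable_comparison_test_ev[rotated])
    show "\<forall>\<^sub>F n in sequentially. norm (1 / (urn_Pi n l)\<^sup>2) \<le> B * real n powr (- 2 * l)"
      using eventually_gt_at_top[of 0]
    proof eventually_elim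
      case (elim n)
      have "(1 / (urn_Pi n l / real n powr l))\<^sup>2 * real n powr (- 2 * l) \<le> B * real n powr (- 2 * l)"
        using B[of n] by (intro mult_right_mono) auto
      moreover have "(real n powr l)\<^sup>2 * real n powr (- 2 * l) = 1"
        using elim by (simp add: power2_eq_square flip: powr_add)
      then have "(1 / (urn_Pi n l / real n powr l))\<^sup>2 * real n powr (- 2 * l) = 1 / (urn_Pi n l)\<^sup>2"
        by (simp add: power_divide)
      ultimately show ?case by simp
    qed
  qed
  then show ?thesis by (rule summable_Suc_iff[THEN iffD2])
qed

text \<open>
  For fixed \<open>\<epsilon>\<close>, the event that the sequence moves by \<open>\<epsilon>\<close> away from its value at \<open>m\<close> at some later
  time has probability at most \<open>r m / \<epsilon>\<^sup>2\<close>; almost surely it fails for some \<open>m\<close>. Letting \<open>\<epsilon>\<close> run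
  through \<open>1 / (j + 1)\<close> gives a Cauchy sequence.
\<close>

lemma (in prob_space) AE_convergent_if_maximal_inequality:
  fixes S :: "nat \<Rightarrow> 'a \<Rightarrow> real"
  assumes [measurable]: "\<And>n. S n \<in> borel_measurable M"
    and max: "\<And>m n \<epsilon>. 0 < \<epsilon> \<Longrightarrow> m \<le> n \<Longrightarrow>
        \<epsilon>\<^sup>2 * prob {\<omega> \<in> space M. \<exists>k\<in>{m..n}. \<epsilon> \<le> \<bar>S k \<omega> - S m \<omega>\<bar>} \<le> r m"
    and r: "r \<longlonglongrightarrow> 0"
  shows "AE \<omega> in M. convergent (\<lambda>n. S n \<omega>)"
proof -
  have close: "AE \<omega> in M. \<exists>m. \<forall>k\<ge>m. \<bar>S k \<omega> - S m \<omega>\<bar> < \<epsilon>" if e: "0 < \<epsilon>" for \<epsilon>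
  proof -
    define B where "B m n = {\<omega> \<in> space M. \<exists>k\<in>{m..n}. \<epsilon> \<le> \<bar>S k \<omega> - S m \<omega>\<bar>}" for m n
    define N where "N m = {\<omega> \<in> space M. \<exists>k\<ge>m. \<epsilon> \<le> \<bar>S k \<omega> - S m \<omega>\<bar>}" for m
    have [measurable]: "B m n \<in> sets M" "N m \<in> sets M" for m n unfolding B_def N_def by measurable
    have N: "\<epsilon>\<^sup>2 * prob (N m) \<le> r m" for m
    proof -
      have "(\<lambda>n. prob (B m (m + n))) \<longlonglongrightarrow> prob (\<Union>n. B m (m + n))"
        by (rule finite_Lim_measure_incseq) (auto simp: incseq_def B_def intro: le_trans)
      moreover have "(\<Union>n. B m (m + n)) = N m"
      proof -
        have "\<exists>n. k \<le> m + n" for k by (rule exI[of _ k]) simp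
        then show ?thesis by (fastforce simp: B_def N_def)
      qed
      ultimately have "(\<lambda>n. \<epsilon>\<^sup>2 * prob (B m (m + n))) \<longlonglongrightarrow> \<epsilon>\<^sup>2 * prob (N m)"
        by (intro tendsto_intros) simp
      then show ?thesis
        by (rule LIMSEQ_le_const2) (use max[OF e] in \<open>auto simp: B_def\<close>)
    qed
    have "\<epsilon>\<^sup>2 * prob (\<Inter>m. N m) \<le> r m" for m
      using N[of m] finite_measure_mono[of "\<Inter>m. N m" "N m"] e
      by (smt (verit, best) INT_lower UNIV_I \<open>\<And>m. N m \<in> events\<close> mult_left_mono zero_le_power2)
    then have "\<epsilon>\<^sup>2 * prob (\<Inter>m. N m) \<le> 0"
      by (intro LIMSEQ_le_const[OF r]) auto
    then have "prob (\<Inter>m. N m) = 0"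
      using e by (simp add: mult_le_0_iff measure_le_0_iff)
    then have "AE \<omega> in M. \<omega> \<notin> (\<Inter>m. N m)"
      by (subst prob_eq_0[symmetric]) auto
    then show ?thesis using AE_space
    proof eventually_elim
      case (elim \<omega>)
      then obtain m where "\<omega> \<notin> N m" by blast
      then have "\<forall>k\<ge>m. \<bar>S k \<omega> - S m \<omega>\<bar> < \<epsilon>" using elim(2) by (auto simp: N_def not_le[symmetric])
      then show ?case by blast
    qed
  qed
  have "AE \<omega> in M. \<forall>j. \<exists>m. \<forall>k\<ge>m. \<bar>S k \<omega> - S m \<omega>\<bar> < 1 / real (Suc j)"
    by (subst AE_all_countable) (auto intro: close)
  then show ?thesis
  proof eventually_elim
    case (elim \<omega>)
    have "Cauchy (\<lambda>n. S n \<omega>)"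
    proof (rule metric_CauchyI)
      fix e :: real assume "0 < e"
      then obtain j where j: "1 / real (Suc j) < e / 2"
        using nat_approx_posE[of "e / 2"] by auto
      from elim obtain m where m: "\<And>k. k \<ge> m \<Longrightarrow> \<bar>S k \<omega> - S m \<omega>\<bar> < 1 / real (Suc j)" by blast
      have "dist (S k \<omega>) (S k' \<omega>) < e" if "k \<ge> m" "k' \<ge> m" for k k'
        using m[OF that(1)] m[OF that(2)] j unfolding dist_real_def by linarith
      then show "\<exists>m. \<forall>k\<ge>m. \<forall>k'\<ge>m. dist (S k \<omega>) (S k' \<omega>) < e" by blast
    qed
    then show ?case by (simp add: Cauchy_convergent_iff)
  qed
qed

locale supercritical_urn = urn_model +
  fixes v :: "real ^ 'b" and l :: real
  assumes eigenvector: "R *v v = l *s v" and supercritical: "1 / 2 < l"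
begin

definition mart :: "nat \<Rightarrow> 'a \<Rightarrow> real" where
  "mart n \<omega> = (C n \<omega> \<bullet> v) / urn_Pi n l"

lemma Pi_pos: "0 < urn_Pi n l"
  using supercritical by (intro urn_Pi_pos) simp

lemma mart_adapted: "k \<le> n \<Longrightarrow> mart k \<in> borel_measurable (natural_filtration M C n)"
proof -
  assume "k \<le> n"
  note [measurable] = composition_adapted[OF this]
  show ?thesis unfolding mart_def by measurable
qed

lemma mart_measurable [measurable]: "mart n \<in> borel_measurable M"
  by (rule filtration_measurable_imp[OF mart_adapted[of n n]]) simp

lemma mart_bound: "\<omega> \<in> space M \<Longrightarrow> \<bar>mart n \<omega>\<bar> \<le> real (Suc n) * norm v / urn_Pi n l"
  unfolding mart_def using inner_composition_bound[of \<omega> n v] Pi_pos[of n]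
  by (simp add: divide_right_mono)

lemma mart_Suc:
  assumes "\<omega> \<in> space M"
  shows "mart (Suc n) \<omega> = mart n \<omega> + l / urn_Pi (Suc n) l * (v $ X (Suc n) \<omega> - draw_mean v n \<omega>)"
proof -
  have r: "1 + l / real (Suc n) > 0" using supercritical by (simp add: field_simps)
  have "C n \<omega> \<bullet> v = real (Suc n) * draw_mean v n \<omega>" by (simp add: draw_mean_def inner_composition)
  then have "(1 + l / real (Suc n)) * (C n \<omega> \<bullet> v) = C n \<omega> \<bullet> v + l * draw_mean v n \<omega>"
    by (simp add: field_simps)
  moreover have "mart n \<omega> = ((1 + l / real (Suc n)) * (C n \<omega> \<bullet> v)) / urn_Pi (Suc n) l"
    using r Pi_pos[of n] by (simp add: mart_def)
  ultimately show ?thesis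
    unfolding mart_def eigenvector_increment[OF eigenvector assms] by (simp add: diff_divide_distrib add_divide_distrib algebra_simps)
qed

text \<open>
  The drawn coordinate of \<open>v\<close> differs from its conditional mean by at most \<open>2 * norm v\<close>.
\<close>

definition step_bound :: "nat \<Rightarrow> real" where
  "step_bound n = (2 * l * norm v)\<^sup>2 * (1 / (urn_Pi (Suc n) l)\<^sup>2)"

lemma summable_step_bound: "summable step_bound"
  unfolding step_bound_def[abs_def] by (intro summable_mult summable_inverse_urn_Pi supercritical)

lemma mart_increment_square:
  assumes w: "\<omega> \<in> space M" shows "(mart (Suc n) \<omega> - mart n \<omega>)\<^sup>2 \<le> step_bound n"
proof -
  have "\<bar>v $ X (Suc n) \<omega> - draw_mean v n \<omega>\<bar> \<le> 2 * norm v"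
    using draw_mean_bound[OF w, of v n] component_le_norm_cart[of v "X (Suc n) \<omega>"] by linarith
  then have "(v $ X (Suc n) \<omega> - draw_mean v n \<omega>)\<^sup>2 \<le> (2 * norm v)\<^sup>2"
    using power_mono[of "\<bar>v $ X (Suc n) \<omega> - draw_mean v n \<omega>\<bar>" "2 * norm v" 2] by simp
  then have "(l / urn_Pi (Suc n) l)\<^sup>2 * (v $ X (Suc n) \<omega> - draw_mean v n \<omega>)\<^sup>2
      \<le> (l / urn_Pi (Suc n) l)\<^sup>2 * (2 * norm v)\<^sup>2"
    by (intro mult_left_mono) auto
  also have "\<dots> = step_bound n" by (simp only: step_bound_def power_mult_distrib power_divide) simp
  finally show ?thesis by (simp only: mart_Suc[OF w] add_diff_cancel_left' power_mult_distrib)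
qed

text \<open>
  This is the martingale property in integrated form. Taking \<open>f\<close> to be the indicator of an event of
  the past gives conditional expectations; taking \<open>f\<close> to be an earlier difference makes the increments
  orthogonal in \<open>L\<^sup>2\<close>.
\<close>

lemma increment_orthogonal:
  assumes f: "f \<in> borel_measurable (natural_filtration M C n)"
    and B: "\<And>\<omega>. \<omega> \<in> space M \<Longrightarrow> \<bar>f \<omega>\<bar> \<le> B"
  shows "(\<integral>\<omega>. f \<omega> * (mart (Suc n) \<omega> - mart n \<omega>) \<partial>M) = 0"
proof -
  let ?c = "l / urn_Pi (Suc n) l"
  have c: "0 \<le> ?c" using supercritical Pi_pos[of "Suc n"] by simp
  have "(\<integral>\<omega>. f \<omega> * (mart (Suc n) \<omega> - mart n \<omega>) \<partial>M)
      = (\<integral>\<omega>. f \<omega> * (?c * (v $ X (Suc n) \<omega> - draw_mean v n \<omega>)) \<partial>M)"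
    by (rule Bochner_Integration.integral_cong) (simp_all add: mart_Suc)
  also have "\<dots> = (\<integral>\<omega>. (\<Sum>i\<in>UNIV. share n i \<omega> * (f \<omega> * (?c * (v $ i - draw_mean v n \<omega>)))) \<partial>M)"
  proof (rule expectation_draw_real[where H = "\<lambda>i \<omega>. f \<omega> * (?c * (v $ i - draw_mean v n \<omega>))"])
    fix i
    note [measurable] = f share_adapted[OF order_refl, of n]
    show "(\<lambda>\<omega>. f \<omega> * (?c * (v $ i - draw_mean v n \<omega>))) \<in> borel_measurable (natural_filtration M C n)"
      unfolding draw_mean_def by measurable
    fix \<omega> assume w: "\<omega> \<in> space M"
    have d: "\<bar>v $ i - draw_mean v n \<omega>\<bar> \<le> 2 * norm v"
      using draw_mean_bound[OF w, of v n] component_le_norm_cart[of v i] by linarith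
    show "\<bar>f \<omega> * (?c * (v $ i - draw_mean v n \<omega>))\<bar> \<le> B * (?c * (2 * norm v))"
      unfolding abs_mult abs_of_nonneg[OF c]
      by (intro mult_mono B w d c order_refl mult_nonneg_nonneg abs_ge_zero order_trans[OF abs_ge_zero B[OF w]])
  qed
  also have "\<dots> = (\<integral>\<omega>. 0 \<partial>M)"
  proof (rule Bochner_Integration.integral_cong[OF refl])
    fix \<omega> assume w: "\<omega> \<in> space M"
    have "(\<Sum>i\<in>UNIV. share n i \<omega> * (f \<omega> * (?c * (v $ i - draw_mean v n \<omega>))))
        = f \<omega> * ?c * ((\<Sum>i\<in>UNIV. share n i \<omega> * v $ i) - draw_mean v n \<omega> * (\<Sum>i\<in>UNIV. share n i \<omega>))"
      by (simp only: right_diff_distrib sum_subtractf sum_distrib_left mult_ac)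
    then show "(\<Sum>i\<in>UNIV. share n i \<omega> * (f \<omega> * (?c * (v $ i - draw_mean v n \<omega>)))) = 0"
      by (simp add: share_sum[OF w] draw_mean_def)
  qed
  finally show ?thesis by simp
qed

lemma integrable_mart: "integrable M (mart n)"
  by (rule integrable_bounded[OF mart_measurable]) (use mart_bound in auto)

lemma expectation_event_mart:
  assumes A: "A \<in> sets (natural_filtration M C m)" and "m \<le> n"
  shows "(\<integral>\<omega>. indicator A \<omega> * mart n \<omega> \<partial>M) = (\<integral>\<omega>. indicator A \<omega> * mart m \<omega> \<partial>M)"
  using \<open>m \<le> n\<close>
proof (induction n rule: dec_induct)
  case (step n)
  have An: "A \<in> sets (natural_filtration M C n)" using A filtration_mono[OF step.hyps(1)] by auto
  have [measurable]: "A \<in> sets M" using A by (rule filtration_imp_events)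
  have int: "integrable M (\<lambda>\<omega>. indicator A \<omega> * mart k \<omega>)" for k
    using integrable_mult_indicator[OF _ integrable_mart, of A k] by simp
  have "(\<integral>\<omega>. indicator A \<omega> * (mart (Suc n) \<omega> - mart n \<omega>) \<partial>M) = 0"
    by (rule increment_orthogonal[where B = 1]) (use An in \<open>auto simp: indicator_def\<close>)
  then have "(\<integral>\<omega>. indicator A \<omega> * mart (Suc n) \<omega> \<partial>M) = (\<integral>\<omega>. indicator A \<omega> * mart n \<omega> \<partial>M)"
    using int by (simp add: right_diff_distrib)
  then show ?case using step.IH by simp
qed simp

theorem martingale_mart: "martingale M (natural_filtration M C) mart"
  unfolding martingale_def
proof (intro conjI allI impI)
  fix m n :: nat assume le: "m \<le> n"
  interpret F: finite_measure_subalgebra M "natural_filtration M C m"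
    by unfold_locales (rule subalgebra_filtration)
  show "AE \<omega> in M. real_cond_exp M (natural_filtration M C m) (mart n) \<omega> = mart m \<omega>"
    by (rule F.real_cond_exp_charact)
       (use expectation_event_mart[OF _ le] integrable_mart mart_adapted[of m m] in
         \<open>auto simp: set_lebesgue_integral_def\<close>)
qed (use subalgebra_filtration filtration_mono integrable_mart mart_adapted in auto)

text \<open>
  Pythagoras for orthogonal increments, localized by a weight \<open>f\<close> and centred at a variable \<open>N\<close> of the
  past: with \<open>N\<close> an earlier value it bounds \<open>L\<^sup>2\<close> distances, with \<open>N\<close> constant it shows that the distance
  from a constant does not decrease, and with \<open>f\<close> an indicator it gives the maximal inequality.
\<close>

lemma square_step:
  assumes f: "f \<in> borel_measurable (natural_filtration M C n)"
    and f1: "\<And>\<omega>. \<omega> \<in> space M \<Longrightarrow> \<bar>f \<omega>\<bar> \<le> 1"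
    and N: "N \<in> borel_measurable (natural_filtration M C n)"
    and B: "\<And>\<omega>. \<omega> \<in> space M \<Longrightarrow> \<bar>N \<omega>\<bar> \<le> B"
  shows "(\<integral>\<omega>. f \<omega> * (mart (Suc n) \<omega> - N \<omega>)\<^sup>2 \<partial>M)
       = (\<integral>\<omega>. f \<omega> * (mart n \<omega> - N \<omega>)\<^sup>2 \<partial>M) + (\<integral>\<omega>. f \<omega> * (mart (Suc n) \<omega> - mart n \<omega>)\<^sup>2 \<partial>M)"
proof -
  have [measurable]: "f \<in> borel_measurable M" "N \<in> borel_measurable M"
    using f N by (auto intro: filtration_measurable_imp)
  define b where "b n = real (Suc n) * norm v / urn_Pi n l" for n
  have mart_b: "\<bar>mart n \<omega>\<bar> \<le> b n" if "\<omega> \<in> space M" for n \<omega> using mart_bound[OF that] by (simp add: b_def)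
  have int: "integrable M (\<lambda>\<omega>. f \<omega> * (mart k \<omega> - N \<omega>)\<^sup>2)" for k
  proof (rule integrable_bounded[of _ "1 * (b k + B)\<^sup>2"])
    fix \<omega> assume w: "\<omega> \<in> space M"
    have "\<bar>mart k \<omega> - N \<omega>\<bar> \<le> b k + B" using mart_b[OF w, of k] B[OF w] by linarith
    from power_mono[OF this, of 2] have "(mart k \<omega> - N \<omega>)\<^sup>2 \<le> (b k + B)\<^sup>2" by simp
    then show "norm (f \<omega> * (mart k \<omega> - N \<omega>)\<^sup>2) \<le> 1 * (b k + B)\<^sup>2"
      using f1[OF w] unfolding real_norm_def abs_mult by (intro mult_mono) auto
  qed simp
  have int2: "integrable M (\<lambda>\<omega>. f \<omega> * (mart (Suc n) \<omega> - mart n \<omega>)\<^sup>2)"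
  proof (rule integrable_bounded[of _ "1 * step_bound n"])
    fix \<omega> assume w: "\<omega> \<in> space M"
    show "norm (f \<omega> * (mart (Suc n) \<omega> - mart n \<omega>)\<^sup>2) \<le> 1 * step_bound n"
      using f1[OF w] mart_increment_square[OF w, of n] unfolding real_norm_def abs_mult
      by (intro mult_mono) auto
  qed simp
  let ?g = "\<lambda>\<omega>. f \<omega> * (mart n \<omega> - N \<omega>)"
  have gb: "\<bar>?g \<omega>\<bar> \<le> 1 * (b n + B)" if w: "\<omega> \<in> space M" for \<omega>
    unfolding abs_mult using f1[OF w] mart_b[OF w, of n] B[OF w] by (intro mult_mono) auto
  have zero: "(\<integral>\<omega>. ?g \<omega> * (mart (Suc n) \<omega> - mart n \<omega>) \<partial>M) = 0"
  proof (rule increment_orthogonal[where B = "1 * (b n + B)"])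
    note [measurable] = f N mart_adapted[OF order_refl, of n]
    show "?g \<in> borel_measurable (natural_filtration M C n)" by measurable
  qed (rule gb)
  have expand: "f \<omega> * (mart (Suc n) \<omega> - N \<omega>)\<^sup>2 - f \<omega> * (mart n \<omega> - N \<omega>)\<^sup>2 - f \<omega> * (mart (Suc n) \<omega> - mart n \<omega>)\<^sup>2
      = 2 * (?g \<omega> * (mart (Suc n) \<omega> - mart n \<omega>))" for \<omega>
    by (simp add: power2_eq_square algebra_simps)
  have "(\<integral>\<omega>. f \<omega> * (mart (Suc n) \<omega> - N \<omega>)\<^sup>2 \<partial>M) - (\<integral>\<omega>. f \<omega> * (mart n \<omega> - N \<omega>)\<^sup>2 \<partial>M)
      - (\<integral>\<omega>. f \<omega> * (mart (Suc n) \<omega> - mart n \<omega>)\<^sup>2 \<partial>M)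
      = (\<integral>\<omega>. f \<omega> * (mart (Suc n) \<omega> - N \<omega>)\<^sup>2 - f \<omega> * (mart n \<omega> - N \<omega>)\<^sup>2 - f \<omega> * (mart (Suc n) \<omega> - mart n \<omega>)\<^sup>2 \<partial>M)"
    using int int2 by simp
  also have "\<dots> = 0" unfolding expand using zero by simp
  finally show ?thesis by simp
qed

lemma integrable_mart_diff: "integrable M (\<lambda>\<omega>. (mart n \<omega> - mart m \<omega>)\<^sup>2)"
  and integrable_mart_const: "integrable M (\<lambda>\<omega>. (mart n \<omega> - c)\<^sup>2)"
proof -
  define b where "b n = real (Suc n) * norm v / urn_Pi n l" for n
  have mart_b: "\<bar>mart n \<omega>\<bar> \<le> b n" if "\<omega> \<in> space M" for n \<omega> using mart_bound[OF that] by (simp add: b_def)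
  show "integrable M (\<lambda>\<omega>. (mart n \<omega> - mart m \<omega>)\<^sup>2)"
  proof (rule integrable_bounded[of _ "(b n + b m)\<^sup>2"])
    fix \<omega> assume w: "\<omega> \<in> space M"
    have "\<bar>mart n \<omega> - mart m \<omega>\<bar> \<le> b n + b m" using mart_b[OF w, of n] mart_b[OF w, of m] by linarith
    from power_mono[OF this, of 2] show "norm ((mart n \<omega> - mart m \<omega>)\<^sup>2) \<le> (b n + b m)\<^sup>2" by simp
  qed simp
  show "integrable M (\<lambda>\<omega>. (mart n \<omega> - c)\<^sup>2)"
  proof (rule integrable_bounded[of _ "(b n + \<bar>c\<bar>)\<^sup>2"])
    fix \<omega> assume w: "\<omega> \<in> space M"
    have "\<bar>mart n \<omega> - c\<bar> \<le> b n + \<bar>c\<bar>" using mart_b[OF w, of n] by linarith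
    from power_mono[OF this, of 2] show "norm ((mart n \<omega> - c)\<^sup>2) \<le> (b n + \<bar>c\<bar>)\<^sup>2" by simp
  qed simp
qed

definition tail_bound :: "nat \<Rightarrow> real" where
  "tail_bound m = (\<Sum>k. step_bound (k + m))"

lemma step_bound_nonneg: "0 \<le> step_bound n" by (simp add: step_bound_def)

lemma tail_bound_tendsto_0: "tail_bound \<longlonglongrightarrow> 0"
  unfolding tail_bound_def[abs_def] by (rule suminf_exist_split2[OF summable_step_bound])

lemma L2_distance:
  assumes "m \<le> n" shows "(\<integral>\<omega>. (mart n \<omega> - mart m \<omega>)\<^sup>2 \<partial>M) \<le> tail_bound m"
proof -
  have "(\<integral>\<omega>. (mart n \<omega> - mart m \<omega>)\<^sup>2 \<partial>M) \<le> (\<Sum>k<n - m. step_bound (k + m))"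
    using assms
  proof (induction n rule: dec_induct)
    case (step n)
    have "(\<integral>\<omega>. (mart (Suc n) \<omega> - mart m \<omega>)\<^sup>2 \<partial>M)
        = (\<integral>\<omega>. (mart n \<omega> - mart m \<omega>)\<^sup>2 \<partial>M) + (\<integral>\<omega>. (mart (Suc n) \<omega> - mart n \<omega>)\<^sup>2 \<partial>M)"
      using square_step[of "\<lambda>_. 1" n "mart m", OF _ _ mart_adapted[OF step.hyps(1)] mart_bound] by simp
    also have "(\<integral>\<omega>. (mart (Suc n) \<omega> - mart n \<omega>)\<^sup>2 \<partial>M) \<le> (\<integral>\<omega>. step_bound n \<partial>M)"
      by (intro integral_mono integrable_mart_diff) (auto simp: mart_increment_square)
    finally show ?case using step by (simp add: Suc_diff_le prob_space)
  qed simp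
  also have "\<dots> \<le> tail_bound m"
    unfolding tail_bound_def using summable_step_bound
    by (intro sum_le_suminf) (auto simp: step_bound_nonneg summable_iff_shift)
  finally show ?thesis .
qed

theorem L2_bounded_mart: "L2_bounded M mart"
  unfolding L2_bounded_def
proof (intro exI allI conjI)
  fix n
  show "integrable M (\<lambda>\<omega>. (mart n \<omega>)\<^sup>2)" using integrable_mart_const[of n 0] by simp
  have "(\<integral>\<omega>. (mart n \<omega>)\<^sup>2 \<partial>M) \<le> (\<integral>\<omega>. 2 * (mart n \<omega> - mart 0 \<omega>)\<^sup>2 + 2 * (mart 0 \<omega>)\<^sup>2 \<partial>M)"
  proof (rule integral_mono)
    fix \<omega>
    show "(mart n \<omega>)\<^sup>2 \<le> 2 * (mart n \<omega> - mart 0 \<omega>)\<^sup>2 + 2 * (mart 0 \<omega>)\<^sup>2"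
      using zero_le_power2[of "mart n \<omega> - 2 * mart 0 \<omega>"] by (simp add: power2_eq_square algebra_simps)
  qed (use integrable_mart_const[of n 0] integrable_mart_const[of 0 0] integrable_mart_diff[of n 0] in auto)
  also have "\<dots> = 2 * (\<integral>\<omega>. (mart n \<omega> - mart 0 \<omega>)\<^sup>2 \<partial>M) + 2 * (\<integral>\<omega>. (mart 0 \<omega>)\<^sup>2 \<partial>M)"
    using integrable_mart_const[of 0 0] integrable_mart_diff[of n 0] by simp
  also have "\<dots> \<le> 2 * tail_bound 0 + 2 * (\<integral>\<omega>. (mart 0 \<omega>)\<^sup>2 \<partial>M)" using L2_distance[of 0 n] by simp
  finally show "(\<integral>\<omega>. (mart n \<omega>)\<^sup>2 \<partial>M) \<le> 2 * tail_bound 0 + 2 * (\<integral>\<omega>. (mart 0 \<omega>)\<^sup>2 \<partial>M)" .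
qed

text \<open>
  Kolmogorov's inequality, by induction on \<open>n\<close> for the stronger claim with the second moment restricted
  to the event \<open>B n\<close>. On \<open>B n\<close> that moment does not decrease in the next step, and on the new part of
  \<open>B (Suc n)\<close> the squared deviation is at least \<open>\<epsilon>\<^sup>2\<close>.
\<close>

lemma maximal_inequality:
  assumes e: "0 < \<epsilon>" and "m \<le> n"
  defines "B \<equiv> \<lambda>n. {\<omega> \<in> space M. \<exists>k\<in>{m..n}. \<epsilon> \<le> \<bar>mart k \<omega> - mart m \<omega>\<bar>}"
  shows "\<epsilon>\<^sup>2 * prob (B n) \<le> tail_bound m"
proof -
  have Bn: "B n \<in> sets (natural_filtration M C n)" for n
  proof -
    have "{\<omega> \<in> space (natural_filtration M C n). \<exists>k\<in>{m..n}. \<epsilon> \<le> \<bar>mart k \<omega> - mart m \<omega>\<bar>}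
        \<in> sets (natural_filtration M C n)"
    proof (rule sets.sets_Collect_finite_Ex)
      fix k assume "k \<in> {m..n}"
      then have [measurable]: "mart k \<in> borel_measurable (natural_filtration M C n)"
          "mart m \<in> borel_measurable (natural_filtration M C n)"
        by (auto intro: mart_adapted)
      show "{\<omega> \<in> space (natural_filtration M C n). \<epsilon> \<le> \<bar>mart k \<omega> - mart m \<omega>\<bar>} \<in> sets (natural_filtration M C n)"
        by measurable
    qed simp
    then show ?thesis by (simp add: B_def)
  qed
  then have [measurable]: "B n \<in> sets M" for n by (rule filtration_imp_events)
  have int: "integrable M (\<lambda>\<omega>. indicator (B k) \<omega> * (mart n \<omega> - mart m \<omega>)\<^sup>2)" for k n
    using integrable_mult_indicator[OF _ integrable_mart_diff, of "B k" n m] by simp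
  have intG: "integrable M (indicat_real (B j - B k))" for j k
    by (rule integrable_bounded[of _ 1]) (auto simp: indicator_def)
  have "\<epsilon>\<^sup>2 * prob (B n) \<le> (\<integral>\<omega>. indicator (B n) \<omega> * (mart n \<omega> - mart m \<omega>)\<^sup>2 \<partial>M)"
    using \<open>m \<le> n\<close>
  proof (induction n rule: dec_induct)
    case base
    have "B m = {}" using e by (auto simp: B_def)
    then show ?case by simp
  next
    case (step n)
    let ?G = "B (Suc n) - B n"
    have sub: "B n \<subseteq> B (Suc n)" by (fastforce simp: B_def)
    have "\<epsilon>\<^sup>2 * prob (B (Suc n)) = \<epsilon>\<^sup>2 * prob (B n) + \<epsilon>\<^sup>2 * prob ?G"
      using finite_measure_Diff[of "B (Suc n)" "B n"] sub by (simp flip: distrib_left)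
    also have "\<dots> \<le> (\<integral>\<omega>. indicator (B n) \<omega> * (mart n \<omega> - mart m \<omega>)\<^sup>2 \<partial>M) + \<epsilon>\<^sup>2 * prob ?G"
      using step.IH by simp
    also have "(\<integral>\<omega>. indicator (B n) \<omega> * (mart n \<omega> - mart m \<omega>)\<^sup>2 \<partial>M)
        \<le> (\<integral>\<omega>. indicator (B n) \<omega> * (mart (Suc n) \<omega> - mart m \<omega>)\<^sup>2 \<partial>M)"
      using square_step[of "indicator (B n)" n "mart m", OF _ _ mart_adapted[OF step.hyps(1)] mart_bound] Bn[of n]
      by (simp add: indicator_def)
    also have "(\<integral>\<omega>. indicator (B n) \<omega> * (mart (Suc n) \<omega> - mart m \<omega>)\<^sup>2 \<partial>M) + \<epsilon>\<^sup>2 * prob ?G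
        = (\<integral>\<omega>. indicator (B n) \<omega> * (mart (Suc n) \<omega> - mart m \<omega>)\<^sup>2 + \<epsilon>\<^sup>2 * indicator ?G \<omega> \<partial>M)"
      using int[of n "Suc n"] intG[of "Suc n" n] by (subst Bochner_Integration.integral_add) simp_all
    also have "\<dots> \<le> (\<integral>\<omega>. indicator (B (Suc n)) \<omega> * (mart (Suc n) \<omega> - mart m \<omega>)\<^sup>2 \<partial>M)"
    proof (rule integral_mono)
      fix \<omega>
      have "\<epsilon>\<^sup>2 \<le> (mart (Suc n) \<omega> - mart m \<omega>)\<^sup>2" if "\<omega> \<in> ?G"
      proof -
        have "\<epsilon> \<le> \<bar>mart (Suc n) \<omega> - mart m \<omega>\<bar>" using that by (auto simp: B_def le_Suc_eq)
        from power_mono[OF this, of 2] e show ?thesis by simp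
      qed
      then show "indicator (B n) \<omega> * (mart (Suc n) \<omega> - mart m \<omega>)\<^sup>2 + \<epsilon>\<^sup>2 * indicator ?G \<omega>
          \<le> indicator (B (Suc n)) \<omega> * (mart (Suc n) \<omega> - mart m \<omega>)\<^sup>2"
        using sub by (auto simp: indicator_def)
    qed (use int intG in auto)
    finally show ?case by simp
  qed
  also have "\<dots> \<le> (\<integral>\<omega>. (mart n \<omega> - mart m \<omega>)\<^sup>2 \<partial>M)"
    by (intro integral_mono int integrable_mart_diff) (auto simp: indicator_def)
  also have "\<dots> \<le> tail_bound m" by (rule L2_distance[OF \<open>m \<le> n\<close>])
  finally show ?thesis .
qed

lemma AE_convergent_mart: "AE \<omega> in M. convergent (\<lambda>n. mart n \<omega>)"
  by (rule AE_convergent_if_maximal_inequality[OF mart_measurable maximal_inequality tail_bound_tendsto_0])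

text \<open>
  By Fatou's lemma the squared \<open>L\<^sup>2\<close> distance of \<open>mart k\<close> from its almost sure limit is at most
  \<open>tail_bound k\<close>. If the limit is a constant, this distance does not decrease in \<open>k\<close>; as the bound tends
  to \<open>0\<close>, it is \<open>0\<close> throughout.
\<close>

lemma constant_if_limit_constant:
  assumes lim: "AE \<omega> in M. (\<lambda>n. mart n \<omega>) \<longlonglongrightarrow> c"
  shows "AE \<omega> in M. mart n \<omega> = c"
proof -
  have upper: "(\<integral>\<omega>. (mart k \<omega> - c)\<^sup>2 \<partial>M) \<le> tail_bound k" for k
  proof -
    have "ennreal (\<integral>\<omega>. (mart k \<omega> - c)\<^sup>2 \<partial>M) = (\<integral>\<^sup>+\<omega>. ennreal ((mart k \<omega> - c)\<^sup>2) \<partial>M)"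
      by (rule nn_integral_eq_integral[symmetric]) (use integrable_mart_const in auto)
    also have "\<dots> = (\<integral>\<^sup>+\<omega>. liminf (\<lambda>j. ennreal ((mart j \<omega> - mart k \<omega>)\<^sup>2)) \<partial>M)"
    proof (rule nn_integral_cong_AE)
      show "AE \<omega> in M. ennreal ((mart k \<omega> - c)\<^sup>2) = liminf (\<lambda>j. ennreal ((mart j \<omega> - mart k \<omega>)\<^sup>2))"
        using lim
      proof eventually_elim
        case (elim \<omega>)
        have "(\<lambda>j. ennreal ((mart j \<omega> - mart k \<omega>)\<^sup>2)) \<longlonglongrightarrow> ennreal ((c - mart k \<omega>)\<^sup>2)"
          by (intro tendsto_ennrealI tendsto_intros elim)
        from lim_imp_Liminf[OF _ this] show ?case by (simp add: power2_commute)
      qed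
    qed
    also have "\<dots> \<le> liminf (\<lambda>j. \<integral>\<^sup>+\<omega>. ennreal ((mart j \<omega> - mart k \<omega>)\<^sup>2) \<partial>M)"
      by (rule nn_integral_liminf) simp
    also have "\<dots> \<le> liminf (\<lambda>j. ennreal (tail_bound k))"
    proof (rule Liminf_mono)
      show "\<forall>\<^sub>F j in sequentially. (\<integral>\<^sup>+\<omega>. ennreal ((mart j \<omega> - mart k \<omega>)\<^sup>2) \<partial>M) \<le> ennreal (tail_bound k)"
        using eventually_ge_at_top[of k]
      proof eventually_elim
        case (elim j)
        have "(\<integral>\<^sup>+\<omega>. ennreal ((mart j \<omega> - mart k \<omega>)\<^sup>2) \<partial>M) = ennreal (\<integral>\<omega>. (mart j \<omega> - mart k \<omega>)\<^sup>2 \<partial>M)"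
          by (rule nn_integral_eq_integral) (use integrable_mart_diff in auto)
        then show ?case using L2_distance[OF elim] by (simp add: ennreal_leI)
      qed
    qed
    also have "\<dots> = ennreal (tail_bound k)" by (simp add: Liminf_const)
    finally show ?thesis
      using L2_distance[of k k] by (subst (asm) ennreal_le_iff) auto
  qed
  have mono: "(\<integral>\<omega>. (mart n \<omega> - c)\<^sup>2 \<partial>M) \<le> (\<integral>\<omega>. (mart k \<omega> - c)\<^sup>2 \<partial>M)" if "n \<le> k" for k
    using that
  proof (induction k rule: dec_induct)
    case (step k)
    have "0 \<le> (\<integral>\<omega>. (mart (Suc k) \<omega> - mart k \<omega>)\<^sup>2 \<partial>M)" by simp
    moreover have "(\<integral>\<omega>. (mart (Suc k) \<omega> - c)\<^sup>2 \<partial>M)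
        = (\<integral>\<omega>. (mart k \<omega> - c)\<^sup>2 \<partial>M) + (\<integral>\<omega>. (mart (Suc k) \<omega> - mart k \<omega>)\<^sup>2 \<partial>M)"
      using square_step[of "\<lambda>_. 1" k "\<lambda>_. c" "\<bar>c\<bar>"] by simp
    ultimately show ?case using step.IH by linarith
  qed simp
  have "(\<integral>\<omega>. (mart n \<omega> - c)\<^sup>2 \<partial>M) \<le> 0"
    using order_trans[OF mono upper] by (intro LIMSEQ_le_const[OF tail_bound_tendsto_0]) blast
  moreover have "0 \<le> (\<integral>\<omega>. (mart n \<omega> - c)\<^sup>2 \<partial>M)" by simp
  ultimately have "(\<integral>\<omega>. (mart n \<omega> - c)\<^sup>2 \<partial>M) = 0" by linarith
  then show ?thesis
    by (subst (asm) integral_nonneg_eq_0_iff_AE) (auto intro: integrable_mart_const)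
qed

lemma prob_draw: "prob {\<omega> \<in> space M. X (Suc n) \<omega> = i} = (\<integral>\<omega>. share n i \<omega> \<partial>M)"
proof -
  have "prob {\<omega> \<in> space M. X (Suc n) \<omega> = i} = (\<integral>\<omega>. indicator {\<omega> \<in> space M. X (Suc n) \<omega> = i} \<omega> \<partial>M)"
    by simp
  also have "\<dots> = (\<integral>\<omega>. (if X (Suc n) \<omega> = i then 1 else 0) \<partial>M)"
    by (rule Bochner_Integration.integral_cong) (auto simp: indicator_def)
  also have "\<dots> = (\<integral>\<omega>. (\<Sum>j\<in>UNIV. share n j \<omega> * (if j = i then 1 else 0)) \<partial>M)"
    by (rule expectation_draw_real[where H = "\<lambda>j \<omega>. if j = i then 1 else 0" and B = 1]) auto
  also have "\<dots> = (\<integral>\<omega>. share n i \<omega> \<partial>M)" by (simp add: if_distrib cong: if_cong)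
  finally show ?thesis .
qed

text \<open>
  If the martingale were constant at times \<open>n\<close> and \<open>n + 1\<close>, then the increment of \<open>C n \<bullet> v\<close> would be
  deterministic, but two colors with different coordinates of \<open>v\<close> are both possible at that trial.
\<close>

lemma limit_not_constant:
  assumes ij: "v $ i \<noteq> v $ j" "0 < (\<integral>\<omega>. share n i \<omega> \<partial>M)" "0 < (\<integral>\<omega>. share n j \<omega> \<partial>M)"
  shows "\<not> (AE \<omega> in M. (\<lambda>n. mart n \<omega>) \<longlonglongrightarrow> c)"
proof
  assume lim: "AE \<omega> in M. (\<lambda>n. mart n \<omega>) \<longlonglongrightarrow> c"
  define d where "d = c * urn_Pi (Suc n) l - c * urn_Pi n l"
  have inc: "AE \<omega> in M. l * v $ X (Suc n) \<omega> = d"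
    using constant_if_limit_constant[OF lim, of n] constant_if_limit_constant[OF lim, of "Suc n"] AE_space
  proof eventually_elim
    case (elim \<omega>)
    have "C k \<omega> \<bullet> v = mart k \<omega> * urn_Pi k l" for k using Pi_pos[of k] by (simp add: mart_def)
    then show ?case using eigenvector_increment[OF eigenvector elim(3), of n] elim(1,2)
      by (simp add: d_def del: urn_Pi_Suc)
  qed
  have "l * v $ k = d" if k: "0 < (\<integral>\<omega>. share n k \<omega> \<partial>M)" for k
  proof (rule ccontr)
    assume "l * v $ k \<noteq> d"
    from inc have "AE \<omega> in M. \<omega> \<notin> {\<omega> \<in> space M. X (Suc n) \<omega> = k}"
      by eventually_elim (use \<open>l * v $ k \<noteq> d\<close> in auto)
    then have "prob {\<omega> \<in> space M. X (Suc n) \<omega> = k} = 0"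
      by (subst prob_eq_0) auto
    then show False using k by (simp add: prob_draw)
  qed
  then have "l * v $ i = l * v $ j" using ij(2,3) by simp
  then show False using ij(1) supercritical by simp
qed

theorem almost_sure_limit:
  assumes ij: "v $ i \<noteq> v $ j" "0 < (\<integral>\<omega>. share n i \<omega> \<partial>M)" "0 < (\<integral>\<omega>. share n j \<omega> \<partial>M)"
  shows "\<exists>W \<in> borel_measurable M.
     (AE \<omega> in M. (\<lambda>n. (C n \<omega> \<bullet> v) / real n powr l) \<longlonglongrightarrow> W \<omega>) \<and> \<not> (\<exists>c. AE \<omega> in M. W \<omega> = c)"
proof (intro bexI conjI notI)
  define \<kappa> where "\<kappa> = 1 / (l * Gamma l)"
  have \<kappa>: "\<kappa> > 0" using supercritical by (simp add: \<kappa>_def Gamma_real_pos)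
  have Pi: "(\<lambda>n. urn_Pi n l / real n powr l) \<longlonglongrightarrow> \<kappa>"
    unfolding \<kappa>_def using supercritical by (intro urn_Pi_asymptotics) simp
  let ?W = "\<lambda>\<omega>. lim (\<lambda>n. mart n \<omega>) * (1 / (l * Gamma l))"
  show "?W \<in> borel_measurable M" by (intro borel_measurable_times borel_measurable_lim_metric) simp_all
  show "AE \<omega> in M. (\<lambda>n. (C n \<omega> \<bullet> v) / real n powr l) \<longlonglongrightarrow> ?W \<omega>"
    using AE_convergent_mart
  proof eventually_elim
    case (elim \<omega>)
    then have "(\<lambda>n. mart n \<omega> * (urn_Pi n l / real n powr l)) \<longlonglongrightarrow> lim (\<lambda>n. mart n \<omega>) * \<kappa>"
      by (intro tendsto_mult Pi) (simp add: convergent_LIMSEQ_iff)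
    then show ?case using Pi_pos by (simp add: mart_def \<kappa>_def less_imp_neq[THEN not_sym])
  qed
  assume "\<exists>c. AE \<omega> in M. ?W \<omega> = c"
  then obtain c where c: "AE \<omega> in M. lim (\<lambda>n. mart n \<omega>) * \<kappa> = c" by (auto simp: \<kappa>_def)
  have "AE \<omega> in M. (\<lambda>n. mart n \<omega>) \<longlonglongrightarrow> c / \<kappa>"
    using AE_convergent_mart c
  proof eventually_elim
    case (elim \<omega>)
    then have "lim (\<lambda>n. mart n \<omega>) = c / \<kappa>" using \<kappa> by (simp add: field_simps)
    then show ?case using elim(1) by (simp add: convergent_LIMSEQ_iff)
  qed
  then show False using limit_not_constant[OF ij] by blast
qed

end

section \<open>Linear algebra of the replacement matrix\<close>

text \<open>
  The difference of the two coordinates of \<open>P *v \<xi> = l *s \<xi>\<close> determines \<open>l\<close>, because the rows of \<open>P\<close>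
  sum to \<open>1\<close> and \<open>\<xi>\<close> is not constant. In particular \<open>l\<close> lies between \<open>- 1\<close> and \<open>1\<close>.
\<close>

lemma two_state_eigenvalue:
  fixes P :: "real ^ 2 ^ 2"
  assumes P: "stochastic_matrix P" and eig: "right_eigenvector P l \<xi>" and l: "l \<noteq> 1"
  shows "\<xi> $ 1 \<noteq> \<xi> $ 2" and "l = P $ 1 $ 1 - P $ 2 $ 1"
proof -
  have rows: "P $ 1 $ 2 = 1 - P $ 1 $ 1" "P $ 2 $ 2 = 1 - P $ 2 $ 1"
    using P by (auto simp: stochastic_matrix_def prob_vector_def sum_2 forall_2)
  have "P *v \<xi> = l *s \<xi>" using eig by (simp add: right_eigenvector_def)
  then have e: "P $ 1 $ 1 * \<xi> $ 1 + P $ 1 $ 2 * \<xi> $ 2 = l * \<xi> $ 1"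
      "P $ 2 $ 1 * \<xi> $ 1 + P $ 2 $ 2 * \<xi> $ 2 = l * \<xi> $ 2"
    by (auto simp: vec_eq_iff forall_2 matrix_vector_mult_def sum_2)
  show neq: "\<xi> $ 1 \<noteq> \<xi> $ 2"
  proof
    assume eq: "\<xi> $ 1 = \<xi> $ 2"
    then have "\<xi> $ 2 = l * \<xi> $ 2" using e(1) by (simp add: rows algebra_simps)
    then have "\<xi> = 0" using l eq by (simp add: vec_eq_iff forall_2)
    then show False using eig by (simp add: right_eigenvector_def)
  qed
  have "(l - (P $ 1 $ 1 - P $ 2 $ 1)) * (\<xi> $ 1 - \<xi> $ 2) = 0"
    using e by (simp add: rows algebra_simps)
  then show "l = P $ 1 $ 1 - P $ 2 $ 1" using neq by simp
qed

text \<open>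
  Left and right eigenvectors for different eigenvalues are orthogonal, so \<open>\<pi>P \<bullet> \<xi> = 0\<close>. Both
  coordinates of \<open>\<xi>\<close> are roots of \<open>x\<^sup>2 - (\<xi> $ 1 + \<xi> $ 2) * x + \<xi> $ 1 * \<xi> $ 2\<close>; averaging this polynomial over
  \<open>\<pi>P\<close> removes the linear term.
\<close>

lemma two_state_stationary_second_moment:
  fixes P :: "real ^ 2 ^ 2"
  assumes \<pi>: "stationary_distribution P \<pi>P" and eig: "right_eigenvector P l \<xi>" and l: "l \<noteq> 1"
  shows "\<pi>P \<bullet> (\<chi> i. (\<xi> $ i)\<^sup>2) = - (\<xi> $ 1 * \<xi> $ 2)" and "0 \<le> - (\<xi> $ 1 * \<xi> $ 2)"
proof -
  have "\<pi>P \<bullet> \<xi> = (\<pi>P v* P) \<bullet> \<xi>" using \<pi> by (simp add: stationary_distribution_def)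
  also have "\<dots> = l * (\<pi>P \<bullet> \<xi>)"
    using eig by (simp add: dot_lmul_matrix right_eigenvector_def scalar_mult_eq_scaleR)
  finally have "\<pi>P \<bullet> \<xi> = 0" using l by simp
  then have orth: "\<pi>P $ 1 * \<xi> $ 1 + \<pi>P $ 2 * \<xi> $ 2 = 0" by (simp add: inner_vec_def sum_2)
  have sum: "\<pi>P $ 2 = 1 - \<pi>P $ 1" and nonneg: "0 \<le> \<pi>P $ 1" "0 \<le> \<pi>P $ 2"
    using \<pi> by (auto simp: stationary_distribution_def prob_vector_def sum_2 forall_2)
  have "\<pi>P $ 1 * (\<xi> $ 1)\<^sup>2 + \<pi>P $ 2 * (\<xi> $ 2)\<^sup>2 + \<xi> $ 1 * \<xi> $ 2
      = (\<pi>P $ 1 * \<xi> $ 1 + \<pi>P $ 2 * \<xi> $ 2) * (\<xi> $ 1 + \<xi> $ 2)"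
    unfolding sum by (simp add: power2_eq_square algebra_simps)
  then show eq: "\<pi>P \<bullet> (\<chi> i. (\<xi> $ i)\<^sup>2) = - (\<xi> $ 1 * \<xi> $ 2)"
    by (simp add: orth inner_vec_def sum_2)
  have "0 \<le> \<pi>P \<bullet> (\<chi> i. (\<xi> $ i)\<^sup>2)" using nonneg by (simp add: inner_vec_def sum_2)
  then show "0 \<le> - (\<xi> $ 1 * \<xi> $ 2)" by (simp add: eq)
qed

text \<open>
  A vanishing off-diagonal entry makes \<open>P\<close> triangular, and then the same entry vanishes in all powers.
\<close>

lemma two_state_irreducible:
  fixes P :: "real ^ 2 ^ 2"
  assumes P: "stochastic_matrix P" "irreducible_matrix P"
  shows "0 < P $ 1 $ 2" and "0 < P $ 2 $ 1"
proof -
  have nonneg: "0 \<le> P $ i $ j" for i j using P by (simp add: stochastic_matrix_def prob_vector_def)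
  have "matrix_power P n $ 1 $ 2 = 0" if "P $ 1 $ 2 = 0" for n
    by (induction n) (simp_all add: matrix_power_def mat_def matrix_matrix_mult_def sum_2 that)
  then show "0 < P $ 1 $ 2"
    using P(2) nonneg[of 1 2] unfolding irreducible_matrix_def by (metis less_irrefl order_le_less)
  have "matrix_power P n $ 2 $ 1 = 0" if "P $ 2 $ 1 = 0" for n
    by (induction n) (simp_all add: matrix_power_def mat_def matrix_matrix_mult_def sum_2 that)
  then show "0 < P $ 2 $ 1"
    using P(2) nonneg[of 2 1] unfolding irreducible_matrix_def by (metis less_irrefl order_le_less)
qed

text \<open>
  In an eigenbasis, \<open>y = (A - l) x\<close> and \<open>(A - l) y = 0\<close> read \<open>(d - l) * x' = y'\<close> and \<open>(d - l) * y' = 0\<close>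
  in each coordinate, so \<open>y' = 0\<close>.
\<close>

lemma diagonalizable_no_generalized_eigenvector:
  fixes A :: "real ^ 'k ^ 'k"
  assumes A: "diagonalizable_matrix A" and y: "A *v x - l *s x = y" and "A *v y = l *s y"
  shows "y = 0"
proof -
  obtain Q D :: "real ^ 'k ^ 'k" where Q: "invertible Q" and D: "\<And>i j. i \<noteq> j \<Longrightarrow> D $ i $ j = 0"
    and AQ: "A = Q ** D ** matrix_inv Q"
    using A unfolding diagonalizable_matrix_def by blast
  have inv: "Q ** matrix_inv Q = mat 1" "matrix_inv Q ** Q = mat 1"
    using someI_ex[OF Q[unfolded invertible_def]] by (auto simp: matrix_inv_def)
  define x' y' where "x' = matrix_inv Q *v x" and "y' = matrix_inv Q *v y"
  have "matrix_inv Q ** A = D ** matrix_inv Q"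
    unfolding AQ by (simp add: matrix_mul_assoc inv)
  then have conj: "matrix_inv Q *v (A *v z) = D *v (matrix_inv Q *v z)" for z
    by (simp add: matrix_vector_mul_assoc)
  have diag: "(D *v z) $ i = D $ i $ i * z $ i" for z i
    using sum.remove[of UNIV i "\<lambda>j. D $ i $ j * z $ j"] D by (simp add: matrix_vector_mult_def)
  have 1: "(D $ i $ i - l) * x' $ i = y' $ i" for i
  proof -
    have "D *v x' - l *s x' = y'"
      using arg_cong[OF y, of "\<lambda>z. matrix_inv Q *v z"]
      by (simp add: matrix_vector_mult_diff_distrib conj x'_def y'_def vector_scalar_commute)
    then show ?thesis by (auto simp: vec_eq_iff diag left_diff_distrib)
  qed
  have 2: "(D $ i $ i - l) * y' $ i = 0" for i
  proof -
    have "D *v y' = l *s y'"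
      using arg_cong[OF assms(3), of "\<lambda>z. matrix_inv Q *v z"] by (simp add: conj y'_def vector_scalar_commute)
    then show ?thesis by (auto simp: vec_eq_iff diag left_diff_distrib)
  qed
  have "y' $ i = 0" for i using 1[of i] 2[of i] by auto
  then have "y' = 0" by (simp add: vec_eq_iff)
  have "y = Q *v y'"
    by (simp add: y'_def matrix_vector_mul_assoc inv)
  then show ?thesis using \<open>y' = 0\<close> by simp
qed

theorem theorem4p1:
  fixes M :: "'a measure"
    and X :: "nat \<Rightarrow> 'a \<Rightarrow> 3"
    and C :: "nat \<Rightarrow> 'a \<Rightarrow> real ^ 3"
    and C0 v2 :: "real ^ 3"
    and R :: "real ^ 3 ^ 3"
    and P :: "real ^ 2 ^ 2"
    and p \<pi>P \<xi> :: "real ^ 2"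
    and s l :: real
  assumes "0 < s" and "s < 1"
    and "prob_vector p"
    and "stochastic_matrix P" and "irreducible_matrix P"
    and "stationary_distribution P \<pi>P"
    and "R = vector [vector [s, (1 - s) * p $ 1, (1 - s) * p $ 2],
                     vector [0, P $ 1 $ 1, P $ 1 $ 2],
                     vector [0, P $ 2 $ 1, P $ 2 $ 2]]"
    and "urn_model M C0 R X C"
    and "C0 $ 1 > 0"
    and "l \<noteq> 1" and "right_eigenvector P l \<xi>"
    and "diagonalizable_matrix R"
    and "v2 = (if l \<noteq> s then vector [(1 - s) * (p \<bullet> \<xi>) / (l - s), \<xi> $ 1, \<xi> $ 2]
               else vector [0, \<xi> $ 1, \<xi> $ 2])"
  shows "(l < 1 / 2 \<longrightarrow>
            weak_conv_m (\<lambda>n. distr M borel (\<lambda>\<omega>. (C n \<omega> \<bullet> v2) / sqrt (real n)))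
              (normal_law 0 (l\<^sup>2 / (1 - 2 * l) * (\<pi>P \<bullet> (\<chi> i. (\<xi> $ i)\<^sup>2)))))
       \<and> (l = 1 / 2 \<longrightarrow>
            weak_conv_m (\<lambda>n. distr M borel (\<lambda>\<omega>. (C n \<omega> \<bullet> v2) / sqrt (real n * ln (real n))))
              (normal_law 0 (l\<^sup>2 * (\<pi>P \<bullet> (\<chi> i. (\<xi> $ i)\<^sup>2)))))
       \<and> (l > 1 / 2 \<longrightarrow>
            martingale M (natural_filtration M C) (\<lambda>n \<omega>. (C n \<omega> \<bullet> v2) / urn_Pi n l)
          \<and> L2_bounded M (\<lambda>n \<omega>. (C n \<omega> \<bullet> v2) / urn_Pi n l)
          \<and> (\<exists>Z \<in> borel_measurable M.
               (AE \<omega> in M. (\<lambda>n. (C n \<omega> \<bullet> v2) / real n powr l) \<longlonglongrightarrow> Z \<omega>)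
             \<and> \<not> (\<exists>c. AE \<omega> in M. Z \<omega> = c)))"
proof -
  note hyps = assms
  interpret urn_model M C0 R X C by fact
  define c where "c = v2 $ 1"
  have v: "v2 $ 1 = c" "v2 $ 2 = \<xi> $ 1" "v2 $ 3 = \<xi> $ 2"
    by (simp_all add: c_def hyps(13))
  have R: "R $ 1 $ 1 = s" "R $ 1 $ 2 = (1 - s) * p $ 1" "R $ 1 $ 3 = (1 - s) * p $ 2"
    "R $ 2 $ 1 = 0" "R $ 2 $ 2 = P $ 1 $ 1" "R $ 2 $ 3 = P $ 1 $ 2"
    "R $ 3 $ 1 = 0" "R $ 3 $ 2 = P $ 2 $ 1" "R $ 3 $ 3 = P $ 2 $ 2"
    by (simp_all add: hyps(7))
  have P\<xi>: "P $ 1 $ 1 * \<xi> $ 1 + P $ 1 $ 2 * \<xi> $ 2 = l * \<xi> $ 1"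
      "P $ 2 $ 1 * \<xi> $ 1 + P $ 2 $ 2 * \<xi> $ 2 = l * \<xi> $ 2"
    using hyps(11) by (auto simp: right_eigenvector_def vec_eq_iff forall_2 matrix_vector_mult_def sum_2)
  \<comment> \<open>The first coordinate of the eigenvector equation; the other two only involve \<open>P\<close> and \<open>\<xi>\<close>.\<close>
  have first: "s * c + (1 - s) * (p $ 1 * \<xi> $ 1 + p $ 2 * \<xi> $ 2) = l * c"
  proof (cases "l = s")
    case False
    then have "c * (l - s) = (1 - s) * (p $ 1 * \<xi> $ 1 + p $ 2 * \<xi> $ 2)"
      by (simp add: c_def hyps(13) inner_vec_def sum_2)
    then show ?thesis by (simp add: algebra_simps)
  next
    case True
    \<comment> \<open>\<open>R - s\<close> maps \<open>(0, \<xi>)\<close> to \<open>(?b, 0, 0)\<close>, which is an eigenvector for \<open>s\<close> unless it vanishes.\<close>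
    let ?b = "(1 - s) * (p $ 1 * \<xi> $ 1 + p $ 2 * \<xi> $ 2)"
    let ?y = "vector [?b, 0, 0] :: real ^ 3"
    have "?y = 0"
    proof (rule diagonalizable_no_generalized_eigenvector[OF hyps(12)])
      show "R *v vector [0, \<xi> $ 1, \<xi> $ 2] - l *s vector [0, \<xi> $ 1, \<xi> $ 2] = ?y"
        using P\<xi> by (simp add: vec_eq_iff forall_3 matrix_vector_mult_def sum_3 R algebra_simps)
      show "R *v ?y = l *s ?y"
        by (simp add: vec_eq_iff forall_3 matrix_vector_mult_def sum_3 R True)
    qed
    then have "?b = 0" by (simp add: vec_eq_iff forall_3)
    moreover have "c = 0" by (simp add: c_def hyps(13) True)
    ultimately show ?thesis by simp
  qed
  have eig: "R *v v2 = l *s v2"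
    using first P\<xi>
    by (simp add: vec_eq_iff forall_3 matrix_vector_mult_def sum_3 R v algebra_simps)
  have l_eq: "l = P $ 1 $ 1 - P $ 2 $ 1" and \<xi>neq: "\<xi> $ 1 \<noteq> \<xi> $ 2"
    using two_state_eigenvalue[OF hyps(4,11,10)] by auto
  have P01: "0 \<le> P $ i $ j" "P $ i $ j \<le> 1" for i j
  proof -
    show "0 \<le> P $ i $ j" using hyps(4) by (simp add: stochastic_matrix_def prob_vector_def)
    show "P $ i $ j \<le> 1"
      using hyps(4) member_le_sum[of j UNIV "\<lambda>j. P $ i $ j"] by (simp add: stochastic_matrix_def prob_vector_def)
  qed
  have l_ge: "- 1 \<le> l" using P01[of 1 1] P01[of 2 1] by (simp add: l_eq)
  define q0 where "q0 = - (\<xi> $ 1 * \<xi> $ 2)"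
  have q0: "\<pi>P \<bullet> (\<chi> i. (\<xi> $ i)\<^sup>2) = q0" "0 \<le> q0"
    using two_state_stationary_second_moment[OF hyps(6,11,10)] by (simp_all add: q0_def)
  have square: "(v2 $ j)\<^sup>2 = (\<xi> $ 1 + \<xi> $ 2) * v2 $ j + q0
      + (if j = 1 then (c - \<xi> $ 1) * (c - \<xi> $ 2) else 0)" for j
    using exhaust_3[of j] by (auto simp: v q0_def power2_eq_square algebra_simps)
  have col: "R $ j $ 1 = 0" if "j \<noteq> 1" for j
    using that exhaust_3[of j] by (auto simp: R)
  have variance: "(\<lambda>n. \<integral>\<omega>. \<bar>l\<^sup>2 * draw_variance v2 n \<omega> - l\<^sup>2 * q0\<bar> \<partial>M) \<longlonglongrightarrow> 0" if "l \<le> 1 / 2"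
    by (rule draw_variance_tendsto[OF eig that square col]) (use hyps(2) in \<open>simp_all add: R\<close>)
  have q: "0 \<le> l\<^sup>2 * q0" using q0 by simp
  have sub: "l < 1 / 2 \<longrightarrow> weak_conv_m (\<lambda>n. distr M borel (\<lambda>\<omega>. (C n \<omega> \<bullet> v2) / sqrt (real n)))
      (normal_law 0 (l\<^sup>2 / (1 - 2 * l) * (\<pi>P \<bullet> (\<chi> i. (\<xi> $ i)\<^sup>2))))"
    using clt_subcritical[OF eig q l_ge _ variance] by (simp add: q0)
  have crit: "l = 1 / 2 \<longrightarrow> weak_conv_m (\<lambda>n. distr M borel (\<lambda>\<omega>. (C n \<omega> \<bullet> v2) / sqrt (real n * ln (real n))))
      (normal_law 0 (l\<^sup>2 * (\<pi>P \<bullet> (\<chi> i. (\<xi> $ i)\<^sup>2))))"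
  proof
    assume half: "l = 1 / 2"
    show "weak_conv_m (\<lambda>n. distr M borel (\<lambda>\<omega>. (C n \<omega> \<bullet> v2) / sqrt (real n * ln (real n))))
      (normal_law 0 (l\<^sup>2 * (\<pi>P \<bullet> (\<chi> i. (\<xi> $ i)\<^sup>2))))"
      unfolding q0 half
      by (rule clt_critical) (use eig q variance in \<open>simp_all only: half order_refl\<close>)
  qed
  \<comment> \<open>After one trial white has produced a non-white color, after two that color has produced the other.\<close>
  define m where "m n i = (\<integral>\<omega>. C n \<omega> $ i \<partial>M)" for n i
  have m_nonneg: "0 \<le> m n i" for n i
    unfolding m_def by (intro integral_nonneg_AE AE_I2 composition_nonneg)
  have m_step: "m (Suc n) j = m n j + (\<Sum>i\<in>UNIV. R $ i $ j * m n i) / real (Suc n)" for n j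
    unfolding m_def expectation_composition_step expectation_share by (simp add: sum_divide_distrib)
  have R0: "0 \<le> R $ i $ j" for i j
    using replacement_stochastic by (simp add: stochastic_matrix_def prob_vector_def)
  have grow: "0 < m (Suc n) j" if "0 < m n i" "0 < R $ i $ j" for n i j
  proof -
    have "R $ i $ j * m n i \<le> (\<Sum>i\<in>UNIV. R $ i $ j * m n i)"
      by (rule member_le_sum) (auto simp: R0 m_nonneg)
    moreover have "0 < R $ i $ j * m n i" using that by simp
    ultimately have "0 < (\<Sum>i\<in>UNIV. R $ i $ j * m n i) / real (Suc n)" by simp
    then show ?thesis unfolding m_step using m_nonneg[of n j] by linarith
  qed
  have keep: "0 < m (Suc n) j" if "0 < m n j" for n j
  proof -
    have "0 \<le> (\<Sum>i\<in>UNIV. R $ i $ j * m n i) / real (Suc n)"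
      by (intro divide_nonneg_nonneg sum_nonneg mult_nonneg_nonneg R0 m_nonneg) simp
    then show ?thesis unfolding m_step using that by linarith
  qed
  have irr: "0 < R $ 2 $ 3" "0 < R $ 3 $ 2" using two_state_irreducible[OF hyps(4,5)] by (simp_all add: R)
  have m0: "0 < m 0 1"
  proof -
    have "m 0 1 = (\<integral>\<omega>. C0 $ 1 \<partial>M)"
      unfolding m_def by (rule Bochner_Integration.integral_cong) (simp_all add: initial)
    then show ?thesis using hyps(9) by (simp add: prob_space)
  qed
  have "0 < R $ 1 $ 2 \<or> 0 < R $ 1 $ 3"
  proof -
    have "0 < p $ 1 \<or> 0 < p $ 2"
      using hyps(3) by (auto simp: prob_vector_def sum_2 forall_2 less_eq_real_def)
    then show ?thesis using hyps(2) by (auto simp: R)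
  qed
  then have "0 < m 2 2 \<and> 0 < m 2 3"
    using grow[of 0 1 2] grow[of 0 1 3] m0 irr grow[of 1 2 3] grow[of 1 3 2] keep[of 1 2] keep[of 1 3]
    by (auto simp: numeral_2_eq_2)
  then have shares: "0 < (\<integral>\<omega>. share 2 2 \<omega> \<partial>M)" "0 < (\<integral>\<omega>. share 2 3 \<omega> \<partial>M)"
    by (simp_all add: expectation_share m_def)
  have sup: "l > 1 / 2 \<longrightarrow>
            martingale M (natural_filtration M C) (\<lambda>n \<omega>. (C n \<omega> \<bullet> v2) / urn_Pi n l)
          \<and> L2_bounded M (\<lambda>n \<omega>. (C n \<omega> \<bullet> v2) / urn_Pi n l)
          \<and> (\<exists>Z \<in> borel_measurable M.
               (AE \<omega> in M. (\<lambda>n. (C n \<omega> \<bullet> v2) / real n powr l) \<longlonglongrightarrow> Z \<omega>)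
             \<and> \<not> (\<exists>c. AE \<omega> in M. Z \<omega> = c))"
  proof
    assume "l > 1 / 2"
    then interpret S: supercritical_urn M C0 R X C v2 l
      by unfold_locales (use eig in auto)
    show "martingale M (natural_filtration M C) (\<lambda>n \<omega>. (C n \<omega> \<bullet> v2) / urn_Pi n l)
          \<and> L2_bounded M (\<lambda>n \<omega>. (C n \<omega> \<bullet> v2) / urn_Pi n l)
          \<and> (\<exists>Z \<in> borel_measurable M.
               (AE \<omega> in M. (\<lambda>n. (C n \<omega> \<bullet> v2) / real n powr l) \<longlonglongrightarrow> Z \<omega>)
             \<and> \<not> (\<exists>c. AE \<omega> in M. Z \<omega> = c))"
      using S.martingale_mart S.L2_bounded_mart S.almost_sure_limit[of 2 3 2] shares \<xi>neq
      by (simp add: S.mart_def[abs_def] v)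
  qed
  show ?thesis using sub crit sup by blast
qed

end
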